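(* Let $n\ge2$ and let $\Omega\subset\mathbb{R}^n$ be a bounded domain. Let $v$ be a superharmonic (respectively, nonnegative subharmonic) function on $\Omega$. Let $\psi:\mathbb{R}_+\to\mathbb{R}_+$ be any strictly permissible function and let $\gamma\le -n$ be a real number. If $$\int_{\Omega}\psi(|v(x)|)\,\delta(x)^{\gamma}\,dm(x)<\infty,$$ then $v$ vanishes identically.
   Context: Here $\mathbb{R}_+=[0,\infty)$, $m$ is Lebesgue measure on $\mathbb{R}^n$, and $\delta(x)$ is the distance from $x\in\Omega$ to $\partial\Omega$. Superharmonic functions take values in $(-\infty,+\infty]$; by convention $\psi(+\infty)=+\infty$. $\varDelta_2$-condition: a function $f:\mathbb{R}_+\to\mathbb{R}_+$ satisfies the $\varDelta_2$-condition if there is a constant $C=C(f)\ge1$ with $f(2t)\le C f(t)$ for all $t\in\mathbb{R}_+$. Strictly permissible: a function $\psi:\mathbb{R}_+\to\mathbb{R}_+$ is strictly permissible if it is a (strictly) increasing surjection such that (b) $\psi^{-1}$ satisfies the $\varDelta_2$-condition; and (c) the function $t\mapsto t/\psi(t)$ is quasi-increasing, i.e. there is a constant $C=C(\psi)\ge1$ such that $\frac{s}{\psi(s)}\le C\,\frac{t}{\psi(t)}$ for all $0<s\le t$. *)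

theory Defs
  imports "HOL-Analysis.Analysis"
begin

definition lower_semicontinuous_on :: "'a::topological_space set \<Rightarrow> ('a \<Rightarrow> ereal) \<Rightarrow> bool" where
  "lower_semicontinuous_on S v \<longleftrightarrow>
     (\<forall>x\<in>S. \<forall>a. a < v x \<longrightarrow> (\<forall>\<^sub>F y in at x within S. a < v y))"

(* The integral of f over A as the integral of the positive part minus the integral of the
   negative part; e2ennreal sends negative values to 0.  It is meaningful when one of the two
   parts is finite.  This is the case where it is used below: a lower semicontinuous function
   with values in (-\<infinity>, \<infinity>] is bounded below on a closed ball. *)
definition ereal_integral_on :: "'a::euclidean_space set \<Rightarrow> ('a \<Rightarrow> ereal) \<Rightarrow> ereal" where
  "ereal_integral_on A f =
     enn2ereal (\<integral>\<^sup>+x\<in>A. e2ennreal (f x) \<partial>lebesgue) -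
     enn2ereal (\<integral>\<^sup>+x\<in>A. e2ennreal (- f x) \<partial>lebesgue)"

definition ball_mean :: "('a::euclidean_space \<Rightarrow> ereal) \<Rightarrow> 'a \<Rightarrow> real \<Rightarrow> ereal" where
  "ball_mean f x r = ereal_integral_on (cball x r) f / ereal (measure lebesgue (cball x r))"

(* Superharmonic on the open set S, via the volume mean value inequality over closed balls
   contained in S.  Only the values of v on S matter.  The constant \<infinity> is admitted. *)
definition superharmonic_on :: "'a::euclidean_space set \<Rightarrow> ('a \<Rightarrow> ereal) \<Rightarrow> bool" where
  "superharmonic_on S v \<longleftrightarrow>
     (\<forall>x\<in>S. - \<infinity> < v x) \<and>
     lower_semicontinuous_on S v \<and>
     (\<forall>x r. 0 < r \<longrightarrow> cball x r \<subseteq> S \<longrightarrow> ball_mean v x r \<le> v x)"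

definition subharmonic_on :: "'a::euclidean_space set \<Rightarrow> ('a \<Rightarrow> ereal) \<Rightarrow> bool" where
  "subharmonic_on S v \<longleftrightarrow> superharmonic_on S (\<lambda>x. - v x)"

(* Functions on [0, \<infinity>) are represented by functions on the reals whose values at negative
   arguments are irrelevant. *)
definition delta2_condition :: "(real \<Rightarrow> real) \<Rightarrow> bool" where
  "delta2_condition f \<longleftrightarrow> (\<exists>C\<ge>1. \<forall>t\<ge>0. f (2 * t) \<le> C * f t)"

definition strictly_permissible :: "(real \<Rightarrow> real) \<Rightarrow> bool" where
  "strictly_permissible \<psi> \<longleftrightarrow>
     strict_mono_on {0..} \<psi> \<and>
     \<psi> ` {0..} = {0..} \<and>
     delta2_condition (inv_into {0..} \<psi>) \<and>
     (\<exists>C\<ge>1. \<forall>s t. 0 < s \<longrightarrow> s \<le> t \<longrightarrow> s / \<psi> s \<le> C * (t / \<psi> t))"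

(* Extension of \<psi> to [0, \<infinity>] by \<psi>(\<infinity>) = \<infinity>. *)
definition extend_infinity :: "(real \<Rightarrow> real) \<Rightarrow> ereal \<Rightarrow> ennreal" where
  "extend_infinity \<psi> t = (if t = \<infinity> then \<infinity> else ennreal (\<psi> (real_of_ereal t)))"

end

theory Submission
  imports Defs
begin

text \<open>
  \<^emph>\<open>Idea.\<close> The negative part \<open>u\<close> of a superharmonic \<open>v\<close> satisfies the sub-mean-value inequality. For
  such \<open>u\<close> also \<open>\<psi> \<circ> u\<close> satisfies it up to a constant, on balls of radius \<open>\<delta>(x)/2\<close>; as
  \<open>\<gamma> \<le> -n\<close>, the integrability hypothesis makes \<open>u\<close> bounded. A bounded function is dominated by its
  composition with \<open>\<psi>\<close>, so \<open>u \<delta>\<^sup>-\<^sup>2\<close> is integrable, and testing against a truncation of a quadratic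
  polynomial forces \<open>u = 0\<close>. Then \<open>v \<ge> 0\<close>, and the same test applied to the bounded superharmonic
  function \<open>min 1 v\<close> gives \<open>v = 0\<close>. For nonnegative subharmonic \<open>v\<close> the first half, applied to
  \<open>-v\<close>, is already enough.
\<close>

subsection \<open>Weighted integrability and the mean value inequality\<close>

text \<open>A ball is connected, so if it contains a point of \<open>S\<close> and misses the
  frontier it cannot leave \<open>S\<close>. For \<open>r < 0\<close> the ball is empty.\<close>

lemma cball_subset_of_infdist_frontier:
  fixes S :: "'a::real_normed_vector set"
  assumes "open S" "x \<in> S" "r < infdist x (frontier S)"
  shows "cball x r \<subseteq> S"
proof (cases "r < 0")
  case False
  have "cball x r \<inter> frontier S = {}"
  proof (rule ccontr)
    assume "cball x r \<inter> frontier S \<noteq> {}"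
    then obtain z where "dist x z \<le> r" "z \<in> frontier S" by auto
    then show False using infdist_le[of z "frontier S" x] assms(3) by linarith
  qed
  moreover have "x \<in> cball x r \<inter> S" using False assms(2) by auto
  moreover have "connected (cball x r)" by (simp add: convex_connected)
  ultimately show ?thesis using connected_Int_frontier[of "cball x r" S] by blast
qed auto

text \<open>Boundedness rules out \<open>S = UNIV\<close>, whose frontier is empty; the convention
  \<open>infdist x {} = 0\<close> would then make the distance vanish.\<close>

lemma infdist_frontier_pos:
  fixes S :: "'a::euclidean_space set"
  assumes "open S" "bounded S" "x \<in> S"
  shows "0 < infdist x (frontier S)"
proof -
  have "S \<noteq> UNIV" using assms(2) not_bounded_UNIV by blast
  then have "frontier S \<noteq> {}" using assms(3) frontier_eq_empty[of S] by auto
  moreover have "x \<notin> frontier S" using assms(1,3) by (simp add: frontier_def interior_open)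
  ultimately show ?thesis using in_closed_iff_infdist_zero[OF frontier_closed, of S x] infdist_nonneg[of x "frontier S"] by fastforce
qed

lemma integrable_indicator_cball_mult:
  fixes h :: "'a::euclidean_space \<Rightarrow> real"
  assumes "continuous_on UNIV h"
  shows "integrable lborel (\<lambda>x. indicator (cball y r) x * h x)"
  using borel_integrable_compact[OF compact_cball continuous_on_subset[OF assms subset_UNIV]]
  by (simp add: mult.commute indicator_def if_distrib cong: if_cong)

text \<open>Passes from mean value inequalities between nonnegative integrals to Bochner integrals,
  where they can be multiplied by the sign \<sigma>.\<close>

lemma nn_integral_cball_eq_integral:
  fixes f :: "'a::euclidean_space \<Rightarrow> real"
  assumes "f \<in> borel_measurable borel" "\<And>x. 0 \<le> f x" "\<And>x. f x \<le> T"
  shows "(\<integral>\<^sup>+y\<in>cball x r. ennreal (f y) \<partial>lborel) = ennreal (\<integral>y. indicator (cball x r) y * f y \<partial>lborel)"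
proof -
  have T: "0 \<le> T" using assms(2,3) order_trans by blast
  have "integrable lborel (\<lambda>y. indicator (cball x r) y *\<^sub>R f y)"
    using assms T emeasure_lborel_cball_finite[of x r]
    by (intro integrableI_bounded_set_indicator[where B = T]) (auto simp: abs_le_iff intro: order_trans[of _ 0])
  then have "(\<integral>\<^sup>+y. ennreal (indicator (cball x r) y * f y) \<partial>lborel) = ennreal (\<integral>y. indicator (cball x r) y * f y \<partial>lborel)"
    using assms(2) by (intro nn_integral_eq_integral) auto
  moreover have "(\<integral>\<^sup>+y. ennreal (indicator (cball x r) y * f y) \<partial>lborel) = (\<integral>\<^sup>+y\<in>cball x r. ennreal (f y) \<partial>lborel)"
    by (intro nn_integral_cong) (auto simp: indicator_def)
  ultimately show ?thesis by simp
qed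

text \<open>Expand \<open>norm x\<close> squared around \<open>y\<close>. The linear term has mean
  zero by symmetry, and the quadratic term is at least \<open>\<epsilon>\<^sup>2/4\<close> outside
  the concentric half ball. That ball has at most half of the volume, which leaves
  \<open>\<epsilon>\<^sup>2/8\<close> on average.\<close>

lemma integral_cball_norm_square_ge:
  fixes y :: "'a::euclidean_space"
  assumes "0 < \<epsilon>"
  shows "measure lborel (cball y \<epsilon>) * ((norm y)\<^sup>2 + \<epsilon>\<^sup>2 / 8)
    \<le> (\<integral>x. indicator (cball y \<epsilon>) x * (norm x)\<^sup>2 \<partial>lborel)"
proof -
  let ?b = "measure lborel (cball y \<epsilon>)"
  \<comment> \<open>The reflection \<open>x \<mapsto> 2y - x\<close> preserves the measure and the
    ball and changes the sign of the integrand.\<close>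
  have lin: "(\<integral>x. indicator (cball y \<epsilon>) x * (y \<bullet> (x - y)) \<partial>lborel) = 0" (is "?L = 0")
  proof -
    have "?L = (\<integral>x. indicator (cball y \<epsilon>) (2 *\<^sub>R y - x) * (y \<bullet> (2 *\<^sub>R y - x - y)) \<partial>lborel)"
    proof -
      have "lborel = distr lborel borel (\<lambda>x. 2 *\<^sub>R y - x)"
        using lborel_affine[of "-1" "2 *\<^sub>R y"] by (simp add: density_1)
      then have "?L = (\<integral>x. indicator (cball y \<epsilon>) x * (y \<bullet> (x - y)) \<partial>distr lborel borel (\<lambda>x. 2 *\<^sub>R y - x))"
        by simp
      also have "\<dots> = (\<integral>x. indicator (cball y \<epsilon>) (2 *\<^sub>R y - x) * (y \<bullet> (2 *\<^sub>R y - x - y)) \<partial>lborel)"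
      proof (rule integral_distr)
        show "(\<lambda>x. indicator (cball y \<epsilon>) x * (y \<bullet> (x - y))) \<in> borel_measurable borel"
          by (rule borel_measurable_times[OF borel_measurable_indicator borel_measurable_continuous_onI])
             (auto intro!: continuous_intros)
      qed simp
      finally show ?thesis .
    qed
    also have "\<dots> = (\<integral>x. - (indicator (cball y \<epsilon>) x * (y \<bullet> (x - y))) \<partial>lborel)"
      by (intro Bochner_Integration.integral_cong)
         (auto simp: indicator_def dist_norm inner_diff_right scaleR_2 norm_minus_commute)
    finally show ?thesis by simp
  qed
  have half: "measure lborel (cball y (\<epsilon>/2)) \<le> ?b / 2"
  proof -
    have "measure lborel (cball y (\<epsilon>/2)) = ?b / 2 ^ DIM('a)"
      using assms content_cball[of "\<epsilon>/2" y] content_cball[of \<epsilon> y] by (simp add: power_divide)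
    also have "\<dots> \<le> ?b / 2 ^ 1"
      by (intro divide_left_mono power_increasing) (auto simp: Suc_le_eq)
    finally show ?thesis by simp
  qed
  have ind: "integrable lborel (indicator (cball y r) :: 'a \<Rightarrow> real)" for r
    using emeasure_lborel_cball_finite by (intro integrable_real_indicator) auto
  have "?b * ((norm y)\<^sup>2 + \<epsilon>\<^sup>2 / 8) \<le> ?b * (norm y)\<^sup>2 + (\<epsilon>\<^sup>2/4) * (?b - measure lborel (cball y (\<epsilon>/2)))"
  proof -
    have "(\<epsilon>\<^sup>2/4) * (?b/2) \<le> (\<epsilon>\<^sup>2/4) * (?b - measure lborel (cball y (\<epsilon>/2)))"
      using half by (intro mult_left_mono) auto
    then show ?thesis by (simp add: algebra_simps)
  qed
  also have "\<dots> = (\<integral>x. (norm y)\<^sup>2 * indicator (cball y \<epsilon>) x + 2 * (indicator (cball y \<epsilon>) x * (y \<bullet> (x - y)))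
      + \<epsilon>\<^sup>2/4 * (indicator (cball y \<epsilon>) x - indicator (cball y (\<epsilon>/2)) x) \<partial>lborel)"
  proof -
    have "integrable lborel (\<lambda>x. indicator (cball y \<epsilon>) x * (y \<bullet> (x - y)))"
      by (intro integrable_indicator_cball_mult continuous_intros)
    then show ?thesis using ind lin by simp
  qed
  also have "\<dots> \<le> (\<integral>x. indicator (cball y \<epsilon>) x * (norm x)\<^sup>2 \<partial>lborel)"
  proof (intro integral_mono)
    show "integrable lborel (\<lambda>x. (norm y)\<^sup>2 * indicator (cball y \<epsilon>) x + 2 * (indicator (cball y \<epsilon>) x * (y \<bullet> (x - y)))
      + \<epsilon>\<^sup>2/4 * (indicator (cball y \<epsilon>) x - indicator (cball y (\<epsilon>/2)) x))"
      using ind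
      by (intro Bochner_Integration.integrable_add integrable_mult_right
          Bochner_Integration.integrable_diff integrable_indicator_cball_mult continuous_intros) auto
    show "integrable lborel (\<lambda>x. indicator (cball y \<epsilon>) x * (norm x)\<^sup>2)"
      by (intro integrable_indicator_cball_mult continuous_intros)
    fix x :: 'a
    have n: "(norm x)\<^sup>2 = (norm y)\<^sup>2 + 2 * (y \<bullet> (x - y)) + (norm (x - y))\<^sup>2"
      by (simp add: power2_norm_eq_inner inner_diff_left inner_diff_right inner_commute)
    show "(norm y)\<^sup>2 * indicator (cball y \<epsilon>) x + 2 * (indicator (cball y \<epsilon>) x * (y \<bullet> (x - y)))
      + \<epsilon>\<^sup>2/4 * (indicator (cball y \<epsilon>) x - indicator (cball y (\<epsilon>/2)) x) \<le> indicator (cball y \<epsilon>) x * (norm x)\<^sup>2"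
    proof (cases "x \<in> cball y (\<epsilon>/2)")
      case True
      then have "x \<in> cball y \<epsilon>" using assms by auto
      then show ?thesis using True n by simp
    next
      case False
      then have "\<epsilon>/2 \<le> norm (x - y)" by (simp add: dist_norm norm_minus_commute)
      then have "(\<epsilon>/2)\<^sup>2 \<le> (norm (x - y))\<^sup>2" using assms by (intro power_mono) auto
      then show ?thesis using False n by (auto simp: indicator_def power_divide)
    qed
  qed
  finally show ?thesis .
qed

text \<open>
  The case \<open>\<sigma> = 1\<close> is that of super-mean-value functions, \<open>\<sigma> = -1\<close> that of sub-mean-value functions.
  The mean value inequality at radius \<open>\<epsilon>\<close> is integrated against the weight \<open>R\<^sup>2 + \<sigma> |x|\<^sup>2\<close> cut off
  sharply to \<open>\<delta> \<ge> 2\<epsilon>\<close>. Averaging over balls is self-adjoint, and applied to the weight it gains a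
  multiple of \<open>\<sigma> \<epsilon>\<^sup>2\<close> where \<open>\<delta> > 3\<epsilon>\<close>; the error of the cutoff lives in the layer
  \<open>\<epsilon> \<le> \<delta> \<le> 3\<epsilon>\<close>, where it is absorbed by \<open>\<epsilon>\<^sup>2 \<delta>\<^sup>-\<^sup>2\<close>.
\<close>
lemma AE_zero_of_weighted_integrable:
  fixes f :: "'a::euclidean_space \<Rightarrow> real"
  assumes \<Omega>: "open \<Omega>" "bounded \<Omega>"
    and f: "f \<in> borel_measurable borel" "\<And>x. 0 \<le> f x" "\<And>x. f x \<le> T" "\<And>x. x \<notin> \<Omega> \<Longrightarrow> f x = 0"
    and \<sigma>: "\<sigma> = 1 \<or> \<sigma> = (-1::real)"
    and mean: "\<And>x r. 0 < r \<Longrightarrow> cball x r \<subseteq> \<Omega> \<Longrightarrow>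
      \<sigma> * (\<integral>y. indicator (cball x r) y * f y \<partial>lborel) \<le> \<sigma> * (measure lborel (cball x r) * f x)"
    and int: "integrable lborel (\<lambda>x. f x / (infdist x (frontier \<Omega>))\<^sup>2)"
  shows "AE x in lborel. f x = 0"
proof -
  let ?\<delta> = "\<lambda>x. infdist x (frontier \<Omega>)"
  let ?F = "\<lambda>x. f x / (?\<delta> x)\<^sup>2"
  obtain R where R: "0 < R" "\<And>x. x \<in> \<Omega> \<Longrightarrow> norm x \<le> R"
    using \<Omega>(2) unfolding bounded_pos by blast
  have \<delta>b: "?\<delta> \<in> borel_measurable borel"
    by (intro borel_measurable_continuous_onI continuous_intros)
  have \<Omega>b: "\<Omega> \<in> sets borel" using \<Omega>(1) by simp
  have \<Omega>fin: "emeasure lborel \<Omega> < \<infinity>" by (rule emeasure_bounded_finite[OF \<Omega>(2)])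
  \<comment> \<open>\<Omega> has finite measure, so bounded Borel functions vanishing off \<Omega>
    are integrable.\<close>
  have bdd_int: "integrable lborel h"
    if "h \<in> borel_measurable borel" "\<And>x. \<bar>h x\<bar> \<le> M" "\<And>x. x \<notin> \<Omega> \<Longrightarrow> h x = 0" for h :: "'a \<Rightarrow> real" and M
  proof (rule Bochner_Integration.integrable_bound)
    show "integrable lborel (\<lambda>x. M * indicator \<Omega> x)" using \<Omega>b \<Omega>fin by simp
    show "AE x in lborel. norm (h x) \<le> norm (M * indicator \<Omega> x)"
    proof (intro AE_I2)
      fix x show "norm (h x) \<le> norm (M * indicator \<Omega> x)"
        using that(2)[of x] that(3)[of x] by (cases "x \<in> \<Omega>") auto
    qed
  qed (simp add: that(1))
  have T0: "0 \<le> T" using f(2,3) order_trans by blast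
  have fint: "integrable lborel f" 
  proof (rule bdd_int)
    show "\<bar>f x\<bar> \<le> T" for x using f(2,3)[of x] by simp
  qed (simp_all add: f)
  \<comment> \<open>The constant is 144 = 18 * 8: the interior gain is
    \<open>\<epsilon>\<^sup>2/8\<close>, and the loss in the boundary layer is
    \<open>2R\<^sup>2\<close> times the factor \<open>9\<epsilon>\<^sup>2\<close> that bounds
    \<open>f\<close> by \<open>?F\<close> there.\<close>
  have key: "(\<integral>x. f x * indicator {x. 3 * \<epsilon> < ?\<delta> x} x \<partial>lborel)
      \<le> 144 * R\<^sup>2 * (\<integral>x. ?F x * indicator {x. ?\<delta> x \<le> 3 * \<epsilon>} x \<partial>lborel)" if \<epsilon>: "0 < \<epsilon>" for \<epsilon>
  proof -
    let ?P = "{x \<in> \<Omega>. 2 * \<epsilon> \<le> ?\<delta> x}"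
    let ?B = "\<lambda>x::'a. cball x \<epsilon>"
    define b where "b = measure lborel (cball (0::'a) \<epsilon>)"
    define W where "W = (\<lambda>x::'a. R\<^sup>2 + \<sigma> * (norm x)\<^sup>2)"
    \<comment> \<open>The cutoff at distance \<open>2 * \<epsilon>\<close> keeps the closed
      \<epsilon>-ball around every point of \<open>?P\<close> inside \<Omega>, so the mean value
      inequality applies wherever \<open>g\<close> is nonzero.\<close>
    define g where "g = (\<lambda>x. indicator ?P x * W x)"
    define G where "G = (\<lambda>y. \<integral>x. indicator (?B y) x * g x \<partial>lborel)"
    \<comment> \<open>The kernel depends symmetrically on \<open>x\<close> and \<open>y\<close>. Its
      two iterated integrals therefore move the ball average from \<open>f\<close> to
      \<open>g\<close>.\<close>
    define H where "H = (\<lambda>x y. g x * f y * indicator (?B (0::'a)) (x - y))"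
    have b: "measure lborel (?B x) = b" for x by (simp add: b_def content_cball \<epsilon> less_imp_le)
    have b0: "0 < b" using \<epsilon> by (simp add: b_def content_cball)
    have Pb: "?P \<in> sets borel" using \<Omega>b \<delta>b by measurable
    have Wb: "W \<in> borel_measurable borel"
      unfolding W_def by (intro borel_measurable_continuous_onI continuous_intros)
    have gb: "g \<in> borel_measurable borel" unfolding g_def using Pb Wb by measurable
    \<comment> \<open>The summand \<open>R\<^sup>2\<close> keeps the weight nonnegative on \<Omega>
      also for \<sigma> = -1.\<close>
    have W0: "0 \<le> W x" "W x \<le> 2 * R\<^sup>2" if "x \<in> \<Omega>" for x
    proof -
      have "(norm x)\<^sup>2 \<le> R\<^sup>2" using R(2)[OF that] by (intro power_mono) auto
      then show "0 \<le> W x" "W x \<le> 2 * R\<^sup>2" using \<sigma> by (auto simp: W_def)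
    qed
    have g0: "0 \<le> g x" "g x \<le> 2 * R\<^sup>2" for x using W0[of x] by (auto simp: g_def indicator_def)
    have Pball: "?B x \<subseteq> \<Omega>" if "x \<in> ?P" for x
      using that \<epsilon> by (intro cball_subset_of_infdist_frontier \<Omega>) auto
    have Bind: "indicator (?B 0) (x - y) = (indicator (?B x) y :: real)" "indicator (?B 0) (x - y) = (indicator (?B y) x :: real)" for x y :: 'a
      by (auto simp: indicator_def dist_norm norm_minus_commute)
    have gint: "integrable lborel g"
    proof (rule bdd_int)
      show "\<bar>g x\<bar> \<le> 2 * R\<^sup>2" for x using g0[of x] by simp
    qed (simp_all add: gb, simp add: g_def)
    have Hint: "integrable (lborel \<Otimes>\<^sub>M lborel) (case_prod H)"
    proof -
      have [measurable]: "(\<lambda>z. g (fst z)) \<in> borel_measurable (lborel \<Otimes>\<^sub>M lborel)"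
          "(\<lambda>z. f (snd z)) \<in> borel_measurable (lborel \<Otimes>\<^sub>M lborel)"
        using gb f(1) by simp_all
      have [measurable]: "(\<lambda>z. indicator (?B (0::'a)) (fst z - snd z) :: real) \<in> borel_measurable (lborel \<Otimes>\<^sub>M lborel)"
        by (rule measurable_compose[of "\<lambda>z. fst z - snd z" _ borel]) (auto intro!: borel_measurable_indicator)
      have "integrable (lborel \<Otimes>\<^sub>M lborel) (\<lambda>(x, y). g x * f y)"
      proof (rule lborel_pair.Fubini_integrable)
        show "(\<lambda>(x, y). g x * f y) \<in> borel_measurable (lborel \<Otimes>\<^sub>M lborel)"
          by (simp add: split_beta)
      qed (use gint fint in \<open>simp_all add: abs_mult\<close>)
      moreover have "case_prod H \<in> borel_measurable (lborel \<Otimes>\<^sub>M lborel)"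
        by (simp add: H_def split_beta)
      moreover have "AE z in lborel \<Otimes>\<^sub>M lborel. norm (case_prod H z) \<le> norm (case z of (x, y) \<Rightarrow> g x * f y)"
        by (intro AE_I2) (simp add: H_def split_beta indicator_def)
      ultimately show ?thesis by (rule Bochner_Integration.integrable_bound)
    qed
    have Hy: "(\<integral>x. H x y \<partial>lborel) = f y * G y" for y
    proof -
      have "H x y = f y * (indicator (?B y) x * g x)" for x using Bind(2)[of x y] by (simp add: H_def)
      then show ?thesis by (simp add: G_def)
    qed
    have Hx: "(\<integral>y. H x y \<partial>lborel) = g x * (\<integral>y. indicator (?B x) y * f y \<partial>lborel)" for x
    proof -
      have "H x y = g x * (indicator (?B x) y * f y)" for y using Bind(1)[of x y] by (simp add: H_def)
      then show ?thesis by simp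
    qed
    have fG: "integrable lborel (\<lambda>y. f y * G y)"
      and gf: "integrable lborel (\<lambda>x. g x * (\<integral>y. indicator (?B x) y * f y \<partial>lborel))"
      using lborel_pair.integrable_snd[OF Hint] lborel_pair.integrable_fst[OF Hint] by (simp_all add: Hx Hy)
    have fub: "(\<integral>y. f y * G y \<partial>lborel) = (\<integral>x. g x * (\<integral>y. indicator (?B x) y * f y \<partial>lborel) \<partial>lborel)"
      using lborel_pair.Fubini_integral[OF Hint] by (simp add: Hx Hy)
    have fg: "integrable lborel (\<lambda>x. f x * g x)"

    proof (rule bdd_int)
      show "\<bar>f x * g x\<bar> \<le> T * (2 * R\<^sup>2)" for x
        using mult_mono[OF f(3) g0(2) T0 g0(1)] f(2) g0(1) by simp
    qed (use f(1) gb in simp_all, simp add: f)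
    \<comment> \<open>The mean value inequality at \<open>x\<close> is multiplied by
      \<open>g x \<ge> 0\<close> and integrated; Fubini then replaces averages of \<open>f\<close>
      by averages of \<open>g\<close>.\<close>
    have le0: "(\<integral>y. \<sigma> * (f y * G y - b * (f y * g y)) \<partial>lborel) \<le> 0"
    proof -
      have "(\<integral>x. \<sigma> * (g x * (\<integral>y. indicator (?B x) y * f y \<partial>lborel)) \<partial>lborel) \<le> (\<integral>x. \<sigma> * (b * (f x * g x)) \<partial>lborel)"
      proof (intro integral_mono)
        fix x
        show "\<sigma> * (g x * (\<integral>y. indicator (?B x) y * f y \<partial>lborel)) \<le> \<sigma> * (b * (f x * g x))"
        proof (cases "x \<in> ?P")
          case True
          have "g x * (\<sigma> * (\<integral>y. indicator (?B x) y * f y \<partial>lborel)) \<le> g x * (\<sigma> * (b * f x))"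
            using mean[OF \<epsilon> Pball[OF True]] g0(1)[of x] by (intro mult_left_mono[of _ _ "g x"]) (simp_all add: b)
          then show ?thesis by (simp add: mult_ac)
        next
          case False
          then have "g x = 0" by (simp add: g_def)
          then show ?thesis by simp
        qed
      qed (use gf fg in auto)
      then show ?thesis using fG fg fub by (simp add: algebra_simps)
    qed
    \<comment> \<open>Three regions: deep inside, the cutoff is invisible and averaging gains; next
      to the boundary, \<open>g\<close> and \<open>G\<close> vanish; in the layer between, only the
      size of the weight is used.\<close>
    have pt: "b * (\<epsilon>\<^sup>2 / 8 * (f y * indicator {x. 3 * \<epsilon> < ?\<delta> x} y)
          - 18 * R\<^sup>2 * \<epsilon>\<^sup>2 * (?F y * indicator {x. ?\<delta> x \<le> 3 * \<epsilon>} y))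
        \<le> \<sigma> * (f y * G y - b * (f y * g y))" for y
    proof (cases "y \<in> \<Omega>")
      case y: True
      consider "3 * \<epsilon> < ?\<delta> y" | "?\<delta> y < \<epsilon>" | "\<epsilon> \<le> ?\<delta> y" "?\<delta> y \<le> 3 * \<epsilon>" by linarith
      then show ?thesis
      proof cases
        case 1
        have sub: "?B y \<subseteq> ?P"
        proof
          fix x assume x: "x \<in> ?B y"
          have "?B y \<subseteq> \<Omega>" using 1 y \<epsilon> by (intro cball_subset_of_infdist_frontier \<Omega>) auto
          moreover have "?\<delta> y \<le> ?\<delta> x + \<epsilon>" using infdist_triangle[of y "frontier \<Omega>" x] x by auto
          ultimately show "x \<in> ?P" using x 1 by auto
        qed
        have "G y = (\<integral>x. R\<^sup>2 * indicator (?B y) x + \<sigma> * (indicator (?B y) x * (norm x)\<^sup>2) \<partial>lborel)"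
          unfolding G_def by (intro Bochner_Integration.integral_cong) (use sub in \<open>auto simp: g_def W_def indicator_def\<close>)
        also have "\<dots> = R\<^sup>2 * b + \<sigma> * (\<integral>x. indicator (?B y) x * (norm x)\<^sup>2 \<partial>lborel)"
          using integrable_indicator_cball_mult[of "\<lambda>x. (norm x)\<^sup>2" y \<epsilon>] integrable_indicator_cball_mult[of "\<lambda>x. 1" y \<epsilon>]
          by (simp add: b continuous_intros)
        finally have G: "G y = R\<^sup>2 * b + \<sigma> * (\<integral>x. indicator (?B y) x * (norm x)\<^sup>2 \<partial>lborel)" .
        have "y \<in> ?P" using y 1 \<epsilon> by auto
        then have g: "g y = R\<^sup>2 + \<sigma> * (norm y)\<^sup>2" by (simp add: g_def W_def)
        \<comment> \<open>The constant \<open>R\<^sup>2\<close> cancels and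
          \<open>\<sigma>\<^sup>2 = 1\<close>, so both signs lead to the same nonnegative
          gain.\<close>
        have "\<sigma> * (G y - b * g y) = (\<integral>x. indicator (?B y) x * (norm x)\<^sup>2 \<partial>lborel) - b * (norm y)\<^sup>2"
          unfolding G g using \<sigma> by (auto simp: algebra_simps)
        also have "\<dots> \<ge> b * (\<epsilon>\<^sup>2 / 8)"
          using integral_cball_norm_square_ge[OF \<epsilon>, of y] by (simp add: b algebra_simps)
        finally have "f y * (b * (\<epsilon>\<^sup>2 / 8)) \<le> f y * (\<sigma> * (G y - b * g y))"
          using f(2) by (intro mult_left_mono) auto
        then show ?thesis using 1 by (simp add: algebra_simps)
      next
        case 2
        \<comment> \<open>Points within \<epsilon> of \<open>y\<close> have distance less than
          \<open>2 * \<epsilon>\<close> to the frontier, hence lie outside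
          \<open>?P\<close>.\<close>
        have "indicator (?B y) x * g x = 0" for x
          using infdist_triangle[of x "frontier \<Omega>" y] 2 by (auto simp: g_def indicator_def dist_commute)
        then have "G y = 0" unfolding G_def by (subst Bochner_Integration.integral_cong[OF refl, where g = "\<lambda>x. 0"]) simp_all
        moreover have "g y = 0" using 2 \<epsilon> by (simp add: g_def)
        ultimately show ?thesis using 2 \<epsilon> b0 f(2)[of y] by simp
      next
        case 3
        have "0 \<le> G y" unfolding G_def using g0 by (intro integral_nonneg_AE AE_I2) auto
        moreover have "G y \<le> 2 * R\<^sup>2 * b"
        proof -
          have "G y \<le> (\<integral>x. 2 * R\<^sup>2 * indicator (?B y) x \<partial>lborel)"
            unfolding G_def
          proof (intro integral_mono)
            show "integrable lborel (\<lambda>x. indicator (?B y) x * g x)"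
              using integrable_mult_indicator[OF _ gint, of "?B y"] by simp
            show "integrable lborel (\<lambda>x. 2 * R\<^sup>2 * indicator (?B y) x)"
              using integrable_indicator_cball_mult[of "\<lambda>x. 2 * R\<^sup>2" y \<epsilon>] by (simp add: mult.commute)
          qed (use g0 in \<open>auto simp: indicator_def\<close>)
          then show ?thesis by (simp add: b)
        qed
        moreover have "0 \<le> b * g y" "b * g y \<le> 2 * R\<^sup>2 * b" using g0[of y] b0 by (simp_all add: mult.commute)
        ultimately have "- (2 * R\<^sup>2 * b) \<le> \<sigma> * (G y - b * g y)" using \<sigma> by auto
        then have 1: "f y * (- (2 * R\<^sup>2 * b)) \<le> f y * (\<sigma> * (G y - b * g y))"
          using f(2) by (intro mult_left_mono) auto
        \<comment> \<open>In the layer the distance is at most \<open>3 * \<epsilon>\<close>, so the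
          singular weight in \<open>?F\<close> compensates the missing factor
          \<open>\<epsilon>\<^sup>2\<close>.\<close>
        have "f y \<le> 9 * \<epsilon>\<^sup>2 * ?F y"
        proof -
          have "(?\<delta> y)\<^sup>2 \<le> (3 * \<epsilon>)\<^sup>2" using 3 \<epsilon> by (intro power_mono) auto
          then have "?F y * (?\<delta> y)\<^sup>2 \<le> ?F y * (3 * \<epsilon>)\<^sup>2" using f(2) by (intro mult_left_mono) auto
          moreover have "?F y * (?\<delta> y)\<^sup>2 = f y" using 3 \<epsilon> by simp
          ultimately show ?thesis by (simp add: power_mult_distrib mult_ac)
        qed
        then have "2 * R\<^sup>2 * b * f y \<le> 2 * R\<^sup>2 * b * (9 * \<epsilon>\<^sup>2 * ?F y)" using b0 by (intro mult_left_mono) auto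
        with 1 show ?thesis using 3 by (simp add: algebra_simps)
      qed
    qed (simp add: f)
    have Fi: "integrable lborel (\<lambda>x. ?F x * indicator {x. ?\<delta> x \<le> 3 * \<epsilon>} x)"
      and fi: "integrable lborel (\<lambda>x. f x * indicator {x. 3 * \<epsilon> < ?\<delta> x} x)"
    proof -
      have "{x. ?\<delta> x \<le> 3 * \<epsilon>} \<in> sets lborel" "{x. 3 * \<epsilon> < ?\<delta> x} \<in> sets lborel"
        using \<delta>b by measurable
      note this[THEN integrable_real_mult_indicator]
      from this(1)[OF int] this(2)[OF fint]
      show "integrable lborel (\<lambda>x. ?F x * indicator {x. ?\<delta> x \<le> 3 * \<epsilon>} x)"
        "integrable lborel (\<lambda>x. f x * indicator {x. 3 * \<epsilon> < ?\<delta> x} x)" .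
    qed
    have "b * (\<epsilon>\<^sup>2 / 8 * (\<integral>y. f y * indicator {x. 3 * \<epsilon> < ?\<delta> x} y \<partial>lborel)
        - 18 * R\<^sup>2 * \<epsilon>\<^sup>2 * (\<integral>y. ?F y * indicator {x. ?\<delta> x \<le> 3 * \<epsilon>} y \<partial>lborel)) \<le> 0" (is "b * (_ * ?I - _ * ?J) \<le> 0")
    proof -
      have "b * (\<epsilon>\<^sup>2 / 8 * ?I - 18 * R\<^sup>2 * \<epsilon>\<^sup>2 * ?J) =
          (\<integral>y. b * (\<epsilon>\<^sup>2 / 8 * (f y * indicator {x. 3 * \<epsilon> < ?\<delta> x} y)
            - 18 * R\<^sup>2 * \<epsilon>\<^sup>2 * (?F y * indicator {x. ?\<delta> x \<le> 3 * \<epsilon>} y)) \<partial>lborel)"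
        using Fi fi by (simp del: times_divide_eq_left)
      also have "\<dots> \<le> (\<integral>y. \<sigma> * (f y * G y - b * (f y * g y)) \<partial>lborel)"
        using Fi fi fG fg by (intro integral_mono pt integrable_mult_right Bochner_Integration.integrable_diff) auto
      finally show ?thesis using le0 by linarith
    qed
    then have "\<epsilon>\<^sup>2 / 8 * ?I \<le> \<epsilon>\<^sup>2 / 8 * (144 * R\<^sup>2 * ?J)"
      using b0 by (simp add: mult_le_0_iff algebra_simps)
    then show ?thesis using \<epsilon> by (simp add: mult_le_cancel_left_pos)
  qed
  \<comment> \<open>Let \<epsilon> = 1/(k+1) tend to 0 in \<open>key\<close>. Each point of \<Omega>
    eventually leaves the layer, so dominated convergence with majorants \<open>f\<close> and
    \<open>?F\<close> gives the integral of \<open>f\<close> on the left and 0 on the right.\<close>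
  have "(\<integral>x. f x \<partial>lborel) \<le> 144 * R\<^sup>2 * (\<integral>x. 0 \<partial>(lborel :: 'a measure))"
  proof (rule tendsto_le[OF sequentially_bot])
    let ?e = "\<lambda>k. 1 / real (Suc k)"
    have lim: "(\<lambda>k. 3 * ?e k) \<longlonglongrightarrow> 0"
      using tendsto_mult_left[OF LIMSEQ_inverse_real_of_nat, of 3] by (simp add: inverse_eq_divide)
    have ev: "\<forall>\<^sub>F k in sequentially. 3 * ?e k < ?\<delta> x" if "x \<in> \<Omega>" for x
      using order_tendstoD(2)[OF lim infdist_frontier_pos[OF \<Omega> that]] .
    show "(\<lambda>k. 144 * R\<^sup>2 * (\<integral>x. ?F x * indicator {x. ?\<delta> x \<le> 3 * ?e k} x \<partial>lborel))
        \<longlonglongrightarrow> 144 * R\<^sup>2 * (\<integral>x. 0 \<partial>(lborel :: 'a measure))"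
    proof (intro tendsto_mult_left integral_dominated_convergence[where w = ?F])
      show "AE x in lborel. (\<lambda>k. ?F x * indicator {x. ?\<delta> x \<le> 3 * ?e k} x) \<longlonglongrightarrow> 0"
      proof (intro AE_I2)
        fix x
        show "(\<lambda>k. ?F x * indicator {x. ?\<delta> x \<le> 3 * ?e k} x) \<longlonglongrightarrow> 0"
        proof (cases "x \<in> \<Omega>")
          case True
          show ?thesis
            by (rule tendsto_eventually) (use ev[OF True] in \<open>eventually_elim, simp\<close>)
        qed (simp add: f)
      qed
      show "(\<lambda>x. ?F x * indicator {x. ?\<delta> x \<le> 3 * ?e k} x) \<in> borel_measurable lborel" for k
        using f(1) \<delta>b by measurable
    qed (use int f(2) in \<open>auto simp: indicator_def\<close>)
    show "(\<lambda>k. \<integral>x. f x * indicator {x. 3 * ?e k < ?\<delta> x} x \<partial>lborel) \<longlonglongrightarrow> (\<integral>x. f x \<partial>lborel)"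
    proof (intro integral_dominated_convergence[where w = f])
      show "AE x in lborel. (\<lambda>k. f x * indicator {x. 3 * ?e k < ?\<delta> x} x) \<longlonglongrightarrow> f x"
      proof (intro AE_I2)
        fix x
        show "(\<lambda>k. f x * indicator {x. 3 * ?e k < ?\<delta> x} x) \<longlonglongrightarrow> f x"
        proof (cases "x \<in> \<Omega>")
          case True
          show ?thesis
            by (rule tendsto_eventually) (use ev[OF True] in \<open>eventually_elim, simp\<close>)
        qed (simp add: f)
      qed
      show "(\<lambda>x. f x * indicator {x. 3 * ?e k < ?\<delta> x} x) \<in> borel_measurable lborel" for k
        using f(1) \<delta>b by measurable
    qed (use fint f(1,2) in \<open>auto simp: indicator_def\<close>)
    show "\<forall>\<^sub>F k in sequentially. (\<integral>x. f x * indicator {x. 3 * ?e k < ?\<delta> x} x \<partial>lborel)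
        \<le> 144 * R\<^sup>2 * (\<integral>x. ?F x * indicator {x. ?\<delta> x \<le> 3 * ?e k} x \<partial>lborel)"
      by (intro always_eventually allI key) simp
  qed
  then have "(\<integral>x. f x \<partial>lborel) = 0" using integral_nonneg_AE[of f lborel] f(2) by (intro antisym) auto
  then show ?thesis using integral_nonneg_eq_0_iff_AE[OF fint] f(2) by simp
qed

subsection \<open>Superharmonic and permissible functions\<close>

lemma open_superlevel:
  assumes "open S" "lower_semicontinuous_on S v"
  shows "open {x \<in> S. a < v x}"
proof (rule Topological_Spaces.openI)
  fix x assume x: "x \<in> {x \<in> S. a < v x}"
  then have "\<forall>\<^sub>F y in at x within S. a < v y"
    using assms(2) by (auto simp: lower_semicontinuous_on_def)
  moreover have "at x within S = at x" using x assms(1) by (intro at_within_open) auto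
  ultimately have "\<forall>\<^sub>F y in at x. a < v y" by simp
  then have "\<forall>\<^sub>F y in nhds x. a < v y" using x by (simp add: eventually_nhds_conv_at)
  moreover have "\<forall>\<^sub>F y in nhds x. y \<in> S" using x assms(1) by (intro eventually_nhds_in_open) auto
  ultimately have "\<forall>\<^sub>F y in nhds x. y \<in> S \<and> a < v y" by (intro eventually_conj)
  then show "\<exists>T. open T \<and> x \<in> T \<and> T \<subseteq> {x \<in> S. a < v x}"
    unfolding eventually_nhds by blast
qed

lemma borel_measurable_lower_semicontinuous:
  assumes "open S" "lower_semicontinuous_on S v"
  shows "(\<lambda>x. if x \<in> S then v x else 0) \<in> borel_measurable borel"
proof (rule borel_measurableI_greater)
  fix a
  have "{x \<in> space borel. a < (if x \<in> S then v x else 0)} = {x \<in> S. a < v x} \<union> (if a < 0 then - S else {})"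
    by auto
  then show "{x \<in> space borel. a < (if x \<in> S then v x else 0)} \<in> sets borel"
    using open_superlevel[OF assms, of a] assms(1) by auto
qed

section \<open>Local lower bounds and truncations of superharmonic functions\<close>

lemma superharmonicD:
  assumes "superharmonic_on S v"
  shows "lower_semicontinuous_on S v" "x \<in> S \<Longrightarrow> - \<infinity> < v x"
  using assms by (auto simp: superharmonic_on_def)

text \<open>The sets where \<open>v\<close> exceeds \<open>-k\<close> are open by lower
  semicontinuity and cover \<open>K\<close> because \<open>v\<close> is never
  \<open>-\<infinity>\<close>; a finite subcover gives the bound.\<close>

lemma superharmonic_bounded_below_compact:
  assumes "open S" "superharmonic_on S v" "compact K" "K \<subseteq> S"
  obtains M :: real where "\<And>x. x \<in> K \<Longrightarrow> - ereal M < v x"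
proof -
  let ?U = "\<lambda>k::nat. {x \<in> S. - ereal (real k) < v x}"
  have o: "open (?U k)" for k
    using open_superlevel assms(1,2) by (auto simp: superharmonic_on_def)
  have "K \<subseteq> (\<Union>k\<in>UNIV. ?U k)"
  proof
    fix x assume x: "x \<in> K"
    then have "- \<infinity> < v x" using assms(2,4) by (auto simp: superharmonic_on_def)
    then obtain k where "- ereal (real k) < v x"
    proof (cases "v x")
      case (real r)
      obtain k where "- r < real k" using reals_Archimedean2 by blast
      then show thesis using that[of k] real by simp
    qed (use that[of 0] in auto)
    then show "x \<in> (\<Union>k\<in>UNIV. ?U k)" using x assms(4) by auto
  qed
  then obtain C where C: "finite C" "K \<subseteq> (\<Union>k\<in>C. ?U k)"
    using compactE_image[OF assms(3), of UNIV ?U] o by auto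
  have "- ereal (real (Max C)) < v x" if x: "x \<in> K" for x
  proof -
    obtain k where k: "k \<in> C" "- ereal (real k) < v x" using C(2) x by blast
    then have "k \<le> Max C" using C(1) by simp
    then have "- ereal (real (Max C)) \<le> - ereal (real k)" by simp
    then show ?thesis using k(2) by (rule le_less_trans)
  qed
  then show thesis using that by blast
qed

text \<open>The integral subtracted in \<open>ball_mean\<close> is that of the negative part. If
  \<open>v x < 0\<close> and this integral is finite, dropping the nonnegative term \<open>P\<close>
  gives the claim; otherwise the left side is 0 or the right side is infinite.\<close>

lemma superharmonic_neg_part_mean:
  fixes v :: "'a::euclidean_space \<Rightarrow> ereal"
  assumes "superharmonic_on S v" "0 < r" "cball x r \<subseteq> S"
  shows "ennreal (measure lborel (cball x r) * real_of_ereal (max 0 (- v x)))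
    \<le> (\<integral>\<^sup>+y\<in>cball x r. ennreal (real_of_ereal (max 0 (- v y))) \<partial>lborel)" (is "ennreal (?m * ?t) \<le> ?N")
proof -
  define P where "P = (\<integral>\<^sup>+y\<in>cball x r. e2ennreal (v y) \<partial>lborel)"
  have fin: "- \<infinity> < v y" if "y \<in> cball x r" for y using assms(1,3) that by (auto simp: superharmonic_on_def)
  have N: "(\<integral>\<^sup>+y\<in>cball x r. e2ennreal (- v y) \<partial>lborel) = ?N"
  proof (rule nn_integral_cong)
    fix y :: 'a
    have "e2ennreal (- v y) = ennreal (real_of_ereal (max 0 (- v y)))" if "y \<in> cball x r"
      using fin[OF that] by (cases "v y") (auto simp: max_def ennreal_neg e2ennreal_neg)
    then show "e2ennreal (- v y) * indicator (cball x r) y = ennreal (real_of_ereal (max 0 (- v y))) * indicator (cball x r) y"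
      by (auto simp: indicator_def)
  qed
  have m: "0 < ?m" using assms(2) by (simp add: content_cball)
  have "ball_mean v x r \<le> v x" using assms by (auto simp: superharmonic_on_def)
  then have le: "enn2ereal P - enn2ereal ?N \<le> ereal ?m * v x"
    using m by (simp add: ball_mean_def ereal_integral_on_def nn_integral_completion P_def N ereal_divide_le_pos)
  show ?thesis
  proof (cases "v x < 0 \<and> ?N < \<infinity>")
    case True
    then obtain s where s: "v x = ereal (- s)" "0 < s"
      using fin[of x] assms(2) by (cases "v x") (auto, metis minus_minus neg_less_0_iff_less)
    obtain q where q: "?N = ennreal q" "0 \<le> q" using True by (cases ?N) auto
    have "0 \<le> enn2ereal P" by simp
    then have "- ereal q \<le> ereal (?m * (- s))"
      using le s q by (cases "enn2ereal P") auto
    then have "?m * s \<le> q" by simp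
    moreover have "?t = s" using s by (simp add: max_def)
    ultimately show ?thesis using q by (simp add: ennreal_leI)
  next
    case False
    then consider "0 \<le> v x" | "?N = \<infinity>" by (auto simp: not_less top_unique)
    then show ?thesis
    proof cases
      case 1
      then have "?t = 0" by (cases "v x") (auto simp: max_def)
      then show ?thesis by simp
    qed simp
  qed
qed

text \<open>If \<open>v x \<ge> 1\<close>, the right side is the volume of the ball and the
  integrand is at most 1. If \<open>v x < 1\<close>, truncation only lowers the integral and leaves
  the value at \<open>x\<close> unchanged. This provides a bounded function that vanishes exactly
  where \<open>v\<close> does.\<close>

lemma superharmonic_min_one_mean:
  fixes v :: "'a::euclidean_space \<Rightarrow> ereal"
  assumes "superharmonic_on S v" "\<And>x. x \<in> S \<Longrightarrow> 0 \<le> v x" "0 < r" "cball x r \<subseteq> S"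
  shows "(\<integral>\<^sup>+y\<in>cball x r. ennreal (real_of_ereal (min 1 (v y))) \<partial>lborel)
    \<le> ennreal (measure lborel (cball x r) * real_of_ereal (min 1 (v x)))" (is "?I \<le> ennreal (?m * _)")
proof -
  define P where "P = (\<integral>\<^sup>+y\<in>cball x r. e2ennreal (v y) \<partial>lborel)"
  have m: "0 < ?m" using assms(3) by (simp add: content_cball)
  have v0: "0 \<le> v y" if "y \<in> cball x r" for y using assms(2,4) that by auto
  have "(\<integral>\<^sup>+y\<in>cball x r. e2ennreal (- v y) \<partial>lborel) = (\<integral>\<^sup>+y. 0 \<partial>(lborel :: 'a measure))"
    using v0 by (intro nn_integral_cong) (auto simp: indicator_def e2ennreal_neg)
  moreover have "ball_mean v x r \<le> v x" using assms by (auto simp: superharmonic_on_def)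
  ultimately have le: "enn2ereal P \<le> ereal ?m * v x"
    using m by (simp add: ball_mean_def ereal_integral_on_def nn_integral_completion P_def zero_ennreal.rep_eq ereal_divide_le_pos)
  have x: "0 \<le> v x" using v0[of x] assms(3) by auto
  show ?thesis
  proof (cases "1 \<le> v x")
    case True
    have "?I \<le> (\<integral>\<^sup>+y. indicator (cball x r) y \<partial>lborel)"
    proof (intro nn_integral_mono)
      fix y :: 'a
      show "ennreal (real_of_ereal (min 1 (v y))) * indicator (cball x r) y \<le> indicator (cball x r) y"
        using v0[of y] by (cases "v y") (auto simp: indicator_def min_def one_ereal_def)
    qed
    also have "\<dots> = ennreal ?m" using emeasure_lborel_cball_finite[of x r] by (simp add: emeasure_eq_ennreal_measure)
    finally show ?thesis using True by (simp add: min_def)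
  next
    case False
    then obtain s where s: "v x = ereal s" "0 \<le> s" "s < 1" using x by (cases "v x") (auto simp: one_ereal_def)
    have "?I \<le> P" unfolding P_def
    proof (intro nn_integral_mono)
      fix y :: 'a
      show "ennreal (real_of_ereal (min 1 (v y))) * indicator (cball x r) y \<le> e2ennreal (v y) * indicator (cball x r) y"
        using v0[of y] by (cases "v y") (auto simp: indicator_def min_def one_ereal_def ennreal_leI)
    qed
    also have "P \<le> ennreal (?m * s)" using le s m by (cases P) auto
    finally show ?thesis using s by (simp add: min_def one_ereal_def)
  qed
qed

section \<open>Growth of strictly permissible functions\<close>

context
  fixes \<psi> :: "real \<Rightarrow> real"
  assumes \<psi>: "strictly_permissible \<psi>"
begin

lemma permissible_less: "0 \<le> s \<Longrightarrow> s < t \<Longrightarrow> \<psi> s < \<psi> t"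
  using \<psi> by (auto simp: strictly_permissible_def strict_mono_on_def)

lemma permissible_le_iff: "0 \<le> s \<Longrightarrow> 0 \<le> t \<Longrightarrow> \<psi> s \<le> \<psi> t \<longleftrightarrow> s \<le> t"
  using permissible_less[of s t] permissible_less[of t s] by (cases s t rule: linorder_cases) auto

lemma permissible_nonneg: "0 \<le> t \<Longrightarrow> 0 \<le> \<psi> t"
  using \<psi> by (auto simp: strictly_permissible_def)

lemma permissible_pos: "0 < t \<Longrightarrow> 0 < \<psi> t"
  using permissible_nonneg[of 0] permissible_less[of 0 t] by simp

lemma permissible_surj:
  assumes "0 \<le> w"
  shows "\<exists>t\<ge>0. \<psi> t = w"
proof -
  have "\<psi> ` {0..} = {0..}" using \<psi> by (simp add: strictly_permissible_def)
  then have "w \<in> \<psi> ` {0..}" using assms by simp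
  then show ?thesis by auto
qed

lemma permissible_zero: "\<psi> 0 = 0"
  using permissible_surj[of 0] permissible_pos by (metis antisym_conv1 order_less_irrefl order_refl)

lemma permissible_measurable:
  assumes "u \<in> borel_measurable M" "\<And>x. 0 \<le> u x"
  shows "(\<lambda>x. \<psi> (u x)) \<in> borel_measurable M"
proof -
  \<comment> \<open>Nothing is known about \<psi> at negative arguments; composing with
    \<open>max 0\<close> gives a function monotone on all reals, hence Borel.\<close>
  have "mono (\<lambda>t. \<psi> (max 0 t))" by (rule monoI) (simp add: permissible_le_iff)
  from measurable_compose[OF assms(1) borel_measurable_mono[OF this]]
  show ?thesis using assms(2) by (simp add: max_def)
qed

text \<open>Iterating the doubling condition of the inverse \<open>k\<close> times gives
  \<open>K = C ^ k\<close>. This turns a comparison of values of \<psi> into one of the arguments,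
  hence a bound on \<open>\<psi> \<circ> u\<close> into one on \<open>u\<close>.\<close>

lemma permissible_doubling: "\<exists>K\<ge>1. \<forall>s\<ge>0. \<forall>t\<ge>0. \<psi> s \<le> 2 ^ k * \<psi> t \<longrightarrow> s \<le> K * t"
proof -
  define \<phi> where "\<phi> = inv_into {0..} \<psi>"
  obtain C where C: "1 \<le> C" "\<And>w. 0 \<le> w \<Longrightarrow> \<phi> (2 * w) \<le> C * \<phi> w"
    using \<psi> unfolding strictly_permissible_def delta2_condition_def \<phi>_def by blast
  have im: "\<psi> ` {0..} = {0..}" using \<psi> by (simp add: strictly_permissible_def)
  have \<phi>: "0 \<le> \<phi> w" "\<psi> (\<phi> w) = w" if "0 \<le> w" for w
    using inv_into_into[of w \<psi> "{0..}"] f_inv_into_f[of w \<psi> "{0..}"] that im by (auto simp: \<phi>_def)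
  have \<phi>\<psi>: "\<phi> (\<psi> t) = t" if "0 \<le> t" for t
    using \<phi>[OF permissible_nonneg[OF that]] permissible_le_iff[OF that, of "\<phi> (\<psi> t)"] permissible_le_iff[of "\<phi> (\<psi> t)" t] that by auto
  have it: "\<phi> (2 ^ k * w) \<le> C ^ k * \<phi> w" if "0 \<le> w" for w
  proof (induction k)
    case (Suc k)
    have "\<phi> (2 ^ Suc k * w) \<le> C * \<phi> (2 ^ k * w)" using C(2)[of "2 ^ k * w"] that by (simp add: mult_ac)
    also have "\<dots> \<le> C * (C ^ k * \<phi> w)" using Suc C(1) by (intro mult_left_mono) auto
    finally show ?case by (simp add: mult_ac)
  qed simp
  have "s \<le> C ^ k * t" if "0 \<le> s" "0 \<le> t" "\<psi> s \<le> 2 ^ k * \<psi> t" for s t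
  proof -
    let ?w = "2 ^ k * \<psi> t"
    have w: "0 \<le> ?w" using permissible_nonneg[OF that(2)] by simp
    have "s \<le> \<phi> ?w" using permissible_le_iff[OF that(1) \<phi>(1)[OF w]] \<phi>(2)[OF w] that(3) by simp
    also have "\<dots> \<le> C ^ k * t" using it[OF permissible_nonneg[OF that(2)]] \<phi>\<psi>[OF that(2)] by simp
    finally show ?thesis .
  qed
  moreover have "1 \<le> C ^ k" using C(1) by simp
  ultimately show ?thesis by blast
qed

text \<open>Condition (c) with the denominator cleared, extended to \<open>s = 0\<close> by
  \<open>\<psi> 0 = 0\<close>. On a range \<open>[0, t]\<close> it dominates the identity by a
  multiple of \<psi>.\<close>

lemma permissible_quasi_increasing: "\<exists>C\<ge>1. \<forall>s t. 0 \<le> s \<longrightarrow> s \<le> t \<longrightarrow> 0 < t \<longrightarrow> s \<le> C * (t / \<psi> t) * \<psi> s"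
proof -
  obtain C where C: "1 \<le> C" "\<And>s t. 0 < s \<Longrightarrow> s \<le> t \<Longrightarrow> s / \<psi> s \<le> C * (t / \<psi> t)"
    using \<psi> unfolding strictly_permissible_def by blast
  have "s \<le> C * (t / \<psi> t) * \<psi> s" if "0 \<le> s" "s \<le> t" "0 < t" for s t
  proof (cases "s = 0")
    case False
    then show ?thesis using C(2)[of s t] that permissible_pos[of s] by (simp add: pos_divide_le_eq)
  qed (simp add: permissible_zero)
  then show ?thesis using C(1) by blast
qed

text \<open>
  If \<open>y\<close> nearly maximizes \<open>\<psi> (u y) (R - dist x y)\<^sup>n\<close>, then \<open>\<psi> \<circ> u\<close>, and by the doubling property
  also \<open>u\<close>, is at most a constant multiple of its value at \<open>y\<close> on the ball around \<open>y\<close> of radius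
  \<open>(R - dist x y) / 2\<close>. There \<open>u\<close> is dominated by \<open>\<psi> \<circ> u\<close>, so that its mean value inequality at
  \<open>y\<close> becomes one for \<open>\<psi> \<circ> u\<close>.
\<close>
lemma permissible_submean_estimate:
  obtains A :: real where "0 < A"
    "\<And>(u :: 'a::euclidean_space \<Rightarrow> real) x R M. \<lbrakk>0 < R; u \<in> borel_measurable borel; \<And>y. 0 \<le> u y;
      \<And>y. y \<in> cball x R \<Longrightarrow> u y \<le> M;
      \<And>y r. 0 < r \<Longrightarrow> cball y r \<subseteq> cball x R \<Longrightarrow>
        ennreal (measure lborel (cball y r) * u y) \<le> (\<integral>\<^sup>+z\<in>cball y r. ennreal (u z) \<partial>lborel)\<rbrakk> \<Longrightarrow>
      ennreal (measure lborel (cball x R) * \<psi> (u x)) \<le> ennreal A * (\<integral>\<^sup>+z\<in>cball x R. ennreal (\<psi> (u z)) \<partial>lborel)"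
proof -
  let ?n = "DIM('a)"
  obtain C where C: "1 \<le> C" "\<And>s t. 0 \<le> s \<Longrightarrow> s \<le> t \<Longrightarrow> 0 < t \<Longrightarrow> s \<le> C * (t / \<psi> t) * \<psi> s"
    using permissible_quasi_increasing by blast
  obtain K where K: "1 \<le> K" "\<And>s t. 0 \<le> s \<Longrightarrow> 0 \<le> t \<Longrightarrow> \<psi> s \<le> 2 ^ (?n + 1) * \<psi> t \<Longrightarrow> s \<le> K * t"
    using permissible_doubling[of "?n + 1"] by blast
  \<comment> \<open>One factor 2 comes from near maximality, \<open>2 ^ ?n\<close> from halving the
    remaining radius, and \<open>C * K\<close> from dominating \<open>u\<close> by
    \<open>\<psi> \<circ> u\<close>. Thus \<open>A\<close> depends only on \<psi> and the
    dimension.\<close>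
  define A where "A = 2 ^ (?n + 1) * (C * K)"
  have A0: "0 < A" using C(1) K(1) by (simp add: A_def)
  show thesis
  proof (rule that[of A])
    show "0 < A" by (rule A0)
    fix u :: "'a \<Rightarrow> real" and x R M
    assume R: "0 < R" and ub: "u \<in> borel_measurable borel" and u0: "\<And>y. 0 \<le> u y"
      and uM: "\<And>y. y \<in> cball x R \<Longrightarrow> u y \<le> M"
      and mean: "\<And>y r. 0 < r \<Longrightarrow> cball y r \<subseteq> cball x R \<Longrightarrow>
        ennreal (measure lborel (cball y r) * u y) \<le> (\<integral>\<^sup>+z\<in>cball y r. ennreal (u z) \<partial>lborel)"
    define D where "D = (\<integral>\<^sup>+z\<in>cball x R. ennreal (\<psi> (u z)) \<partial>lborel)"
    let ?\<omega> = "unit_ball_vol (real ?n)"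
    have "ennreal (measure lborel (cball x R) * \<psi> (u x)) \<le> ennreal A * D"
    proof (cases "u x = 0")
      case False
      then have ux: "0 < \<psi> (u x)" using u0[of x] by (intro permissible_pos) simp
      \<comment> \<open>The factor vanishes on the boundary sphere, so a near-maximizer lies in the
        open ball with room around it. The exponent matches the scaling of volume, so that
        \<open>\<Phi> x\<close> is \<open>\<psi> (u x)\<close> times the volume up to the unit ball
        constant.\<close>
      define \<Phi> where "\<Phi> = (\<lambda>y. \<psi> (u y) * (R - dist x y) ^ ?n)"
      define S where "S = (SUP y\<in>cball x R. \<Phi> y)"
      have "\<Phi> y \<le> \<psi> M * R ^ ?n" if "y \<in> cball x R" for y
      proof -
        have "0 \<le> M" using uM[OF that] u0[of y] by linarith
        then show ?thesis unfolding \<Phi>_def using that uM[OF that] u0[of y]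
          by (intro mult_mono power_mono) (auto simp: permissible_le_iff permissible_nonneg)
      qed
      then have bdd: "bdd_above (\<Phi> ` cball x R)" by (rule bdd_aboveI2)
      have \<Phi>x: "\<Phi> x \<le> S" unfolding S_def using R by (intro cSUP_upper bdd) auto
      have "0 < \<Phi> x" using ux R by (simp add: \<Phi>_def)
      then have "S / 2 < S" using \<Phi>x by linarith
      then obtain y where y: "y \<in> cball x R" "S / 2 < \<Phi> y"
        using less_cSUP_iff[OF _ bdd, of "S/2"] R unfolding S_def by fastforce
      then have "0 < \<Phi> y" using \<open>0 < \<Phi> x\<close> \<Phi>x by linarith
      define \<rho> where "\<rho> = (R - dist x y) / 2"
      have "R - dist x y = 2 * \<rho>" by (simp add: \<rho>_def)
      then have \<Phi>y: "\<Phi> y = \<psi> (u y) * (2 * \<rho>) ^ ?n" by (simp only: \<Phi>_def)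
      have "dist x y \<noteq> R" using \<open>0 < \<Phi> y\<close> by (auto simp: \<Phi>_def power_0_left)
      then have \<rho>: "0 < \<rho>" using y(1) by (simp add: \<rho>_def)
      have uy: "0 < u y"
        using \<open>0 < \<Phi> y\<close> u0[of y] permissible_zero by (cases "u y = 0") (auto simp: \<Phi>_def)
      have sub: "cball y \<rho> \<subseteq> cball x R"
      proof
        fix z assume "z \<in> cball y \<rho>"
        then show "z \<in> cball x R" using dist_triangle[of x z y] \<rho> by (auto simp: \<rho>_def)
      qed
      have uz: "u z \<le> K * u y" if z: "z \<in> cball y \<rho>" for z
      proof (rule K(2)[OF u0 u0])
        \<comment> \<open>On the ball of radius \<rho> around \<open>y\<close> the factor drops at
          most from \<open>2 * \<rho>\<close> to \<rho>, which costs \<open>2 ^ ?n\<close>;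
          comparing with the supremum costs another 2.\<close>
        have "\<rho> \<le> R - dist x z" using dist_triangle[of x z y] z by (auto simp: \<rho>_def field_simps)
        then have "\<psi> (u z) * \<rho> ^ ?n \<le> \<Phi> z"
          unfolding \<Phi>_def using \<rho> u0 by (intro mult_left_mono power_mono) (auto simp: permissible_nonneg)
        also have "\<dots> \<le> S" unfolding S_def using z sub by (intro cSUP_upper bdd) auto
        also have "\<dots> \<le> 2 * \<Phi> y" using y(2) by simp
        also note \<Phi>y
        finally show "\<psi> (u z) \<le> 2 ^ (?n + 1) * \<psi> (u y)" using \<rho> by (simp add: power_mult_distrib mult_ac)
      qed
      note py = permissible_pos[OF uy]
      \<comment> \<open>Quasi-increase up to \<open>K * u y\<close>, with
        \<open>\<psi> (K * u y)\<close> replaced by the smaller \<open>\<psi> (u y)\<close>. In this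
        form \<open>c * \<psi> (u y)\<close> is a multiple of \<open>u y\<close>, so that
        \<open>u y\<close> cancels below.\<close>
      define c where "c = C * (K * u y / \<psi> (u y))"
      have c0: "0 < c" using C(1) K(1) uy py by (simp add: c_def)
      have c\<psi>: "c * \<psi> (u y) = C * K * u y" using py by (simp add: c_def)
      have "ennreal (measure lborel (cball y \<rho>) * u y) \<le> (\<integral>\<^sup>+z\<in>cball y \<rho>. ennreal (u z) \<partial>lborel)"
        by (rule mean[OF \<rho> sub])
      also have "\<dots> \<le> (\<integral>\<^sup>+z. ennreal c * (ennreal (\<psi> (u z)) * indicator (cball x R) z) \<partial>lborel)"
      proof (intro nn_integral_mono)
        fix z
        show "ennreal (u z) * indicator (cball y \<rho>) z \<le> ennreal c * (ennreal (\<psi> (u z)) * indicator (cball x R) z)"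
        proof (cases "z \<in> cball y \<rho>")
          case True
          have "u y \<le> K * u y" using K(1) uy by simp
          then have "\<psi> (u y) \<le> \<psi> (K * u y)" using permissible_le_iff[of "u y" "K * u y"] uy K(1) by simp
          then have "K * u y / \<psi> (K * u y) \<le> K * u y / \<psi> (u y)"
            using uy K(1) permissible_pos[OF uy] by (intro divide_left_mono) auto
          then have "C * (K * u y / \<psi> (K * u y)) \<le> c"
            unfolding c_def using C(1) by (intro mult_left_mono) auto
          then have "C * (K * u y / \<psi> (K * u y)) * \<psi> (u z) \<le> c * \<psi> (u z)"
            using permissible_nonneg[OF u0[of z]] by (rule mult_right_mono)
          then have "u z \<le> c * \<psi> (u z)" using C(2)[OF u0 uz[OF True]] uy K(1) by simp
          then have "ennreal (u z) \<le> ennreal (c * \<psi> (u z))" by (rule ennreal_leI)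
          also have "\<dots> = ennreal c * ennreal (\<psi> (u z))"
            using c0 permissible_nonneg[OF u0[of z]] by (intro ennreal_mult) auto
          finally have "ennreal (u z) \<le> ennreal c * ennreal (\<psi> (u z))" .
          then show ?thesis using True sub by auto
        qed simp
      qed
      also have "\<dots> = ennreal c * D"
        unfolding D_def using permissible_measurable[OF ub u0] by (intro nn_integral_cmult)
           (auto intro!: borel_measurable_times_ennreal borel_measurable_indicator)
      finally have le: "ennreal (measure lborel (cball y \<rho>) * u y) \<le> ennreal c * D" .
      show ?thesis
      proof (cases D)
        case (real d)
        have "ennreal c * ennreal d = ennreal (c * d)" using c0 real by (simp add: ennreal_mult)
        then have "measure lborel (cball y \<rho>) * u y \<le> c * d"
          using le c0 unfolding real(2) by (metis ennreal_le_iff less_imp_le mult_nonneg_nonneg real(1))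
        then have "measure lborel (cball y \<rho>) * u y * \<psi> (u y) \<le> c * d * \<psi> (u y)"
          using py by (intro mult_right_mono) auto
        also have "\<dots> = c * \<psi> (u y) * d" by (simp only: mult_ac)
        also have "\<dots> = C * K * u y * d" by (simp only: c\<psi>)
        finally have "u y * (measure lborel (cball y \<rho>) * \<psi> (u y)) \<le> u y * (C * K * d)"
          by (simp only: mult_ac)
        then have 1: "measure lborel (cball y \<rho>) * \<psi> (u y) \<le> C * K * d" using uy by (rule mult_left_le_imp_le)
        have "measure lborel (cball x R) * \<psi> (u x) = ?\<omega> * \<Phi> x"
          using R by (simp add: content_cball \<Phi>_def)
        also have "\<dots> \<le> ?\<omega> * (2 * \<Phi> y)" using \<Phi>x y(2) by (intro mult_left_mono) auto
        also have "\<dots> = 2 ^ (?n + 1) * (measure lborel (cball y \<rho>) * \<psi> (u y))"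
          using \<rho> by (simp add: content_cball \<Phi>y power_mult_distrib mult_ac)
        also have "\<dots> \<le> 2 ^ (?n + 1) * (C * K * d)" using 1 by (intro mult_left_mono) auto
        finally have "ennreal (measure lborel (cball x R) * \<psi> (u x)) \<le> ennreal (A * d)"
          by (intro ennreal_leI) (simp only: A_def mult.assoc)
        also have "\<dots> = ennreal A * D" unfolding real(2) using real(1) A0 by (intro ennreal_mult) auto
        finally show ?thesis .
      next
        case top
        then show ?thesis using A0 by (simp add: ennreal_mult_top)
      qed
    qed (simp add: permissible_zero)
    then show "ennreal (measure lborel (cball x R) * \<psi> (u x))
        \<le> ennreal A * (\<integral>\<^sup>+z\<in>cball x R. ennreal (\<psi> (u z)) \<partial>lborel)"
      by (simp only: D_def)
  qed
qed

end

subsection \<open>Weights given by powers of the boundary distance\<close>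

text \<open>The function \<open>d powr (\<gamma> - \<beta>)\<close> is nonincreasing, hence minimal
  at \<open>D\<close>. On a bounded domain a weight of exponent \<gamma> therefore controls weights
  of larger exponent; \<beta> will be -2 and minus the dimension.\<close>

lemma powr_le_powr_bounded:
  fixes d :: real
  assumes "0 < d" "d \<le> D" "\<gamma> \<le> \<beta>"
  shows "D powr (\<gamma> - \<beta>) * d powr \<beta> \<le> d powr \<gamma>"
proof -
  have "D powr (\<gamma> - \<beta>) \<le> d powr (\<gamma> - \<beta>)" using assms by (intro powr_mono2') auto
  then have "D powr (\<gamma> - \<beta>) * d powr \<beta> \<le> d powr (\<gamma> - \<beta>) * d powr \<beta>" by (intro mult_right_mono) auto
  also have "\<dots> = d powr \<gamma>" by (simp flip: powr_add)
  finally show ?thesis .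
qed

lemma infdist_frontier_bounded:
  fixes S :: "'a::euclidean_space set"
  assumes "bounded S"
  obtains D where "0 < D" "\<And>x. x \<in> S \<Longrightarrow> infdist x (frontier S) \<le> D"
proof (cases "frontier S = {}")
  case True
  then show thesis using that[of 1] by (simp add: infdist_def)
next
  case False
  then obtain z where z: "z \<in> frontier S" by blast
  obtain B where B: "\<And>x. x \<in> S \<Longrightarrow> dist z x \<le> B" using assms bounded_any_center[of S z] by blast
  show thesis
  proof (rule that[of "max 1 B"])
    fix x assume "x \<in> S"
    then show "infdist x (frontier S) \<le> max 1 B" using infdist_le[OF z, of x] B[of x] by (simp add: dist_commute)
  qed simp
qed

context
  fixes \<Omega> :: "'a::euclidean_space set" and \<psi> :: "real \<Rightarrow> real" and \<gamma> :: real
  assumes \<Omega>: "open \<Omega>" "bounded \<Omega>" and \<psi>: "strictly_permissible \<psi>"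
begin

text \<open>For bounded \<open>f\<close>, quasi-increase gives \<open>f\<close> at most a constant
  times \<open>\<psi> \<circ> f\<close>, and \<open>\<gamma> \<le> -2\<close> compares the weights.
  The hypothesis thus yields the integrability needed for the quadratic test.\<close>

lemma AE_zero_of_permissible_integral:
  fixes f :: "'a \<Rightarrow> real"
  assumes \<gamma>: "\<gamma> \<le> - 2"
    and f: "f \<in> borel_measurable borel" "\<And>x. 0 \<le> f x" "\<And>x. f x \<le> T" "\<And>x. x \<notin> \<Omega> \<Longrightarrow> f x = 0"
    and \<sigma>: "\<sigma> = 1 \<or> \<sigma> = (-1::real)"
    and mean: "\<And>x r. 0 < r \<Longrightarrow> cball x r \<subseteq> \<Omega> \<Longrightarrow>
      \<sigma> * (\<integral>y. indicator (cball x r) y * f y \<partial>lborel) \<le> \<sigma> * (measure lborel (cball x r) * f x)"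
    and fin: "(\<integral>\<^sup>+x\<in>\<Omega>. ennreal (\<psi> (f x)) * ennreal (infdist x (frontier \<Omega>) powr \<gamma>) \<partial>lborel) < \<infinity>"
  shows "AE x in lborel. f x = 0"
proof -
  let ?\<delta> = "\<lambda>x. infdist x (frontier \<Omega>)"
  have [measurable]: "?\<delta> \<in> borel_measurable borel"
    by (intro borel_measurable_continuous_onI continuous_intros)
  have [measurable]: "f \<in> borel_measurable borel" "\<Omega> \<in> sets borel" using f(1) \<Omega>(1) by simp_all
  have [measurable]: "(\<lambda>x. \<psi> (f x)) \<in> borel_measurable borel" by (rule permissible_measurable[OF \<psi> f(1,2)])
  obtain D where D: "0 < D" "\<And>x. x \<in> \<Omega> \<Longrightarrow> ?\<delta> x \<le> D" using infdist_frontier_bounded[OF \<Omega>(2)] by blast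
  obtain C where C: "1 \<le> C" "\<And>s t. 0 \<le> s \<Longrightarrow> s \<le> t \<Longrightarrow> 0 < t \<Longrightarrow> s \<le> C * (t / \<psi> t) * \<psi> s"
    using permissible_quasi_increasing[OF \<psi>] by blast
  \<comment> \<open>The maximum with 1 only ensures a positive endpoint, as quasi-increase
    requires.\<close>
  let ?t = "max T 1"
  let ?c = "C * (?t / \<psi> ?t) / D powr (\<gamma> + 2)"
  have t: "0 < ?t" "0 < \<psi> ?t" using permissible_pos[OF \<psi>, of ?t] by auto
  have c: "0 \<le> ?c" using C(1) t by simp
  have ptw: "f x / (?\<delta> x)\<^sup>2 \<le> ?c * (\<psi> (f x) * ?\<delta> x powr \<gamma>)" if x: "x \<in> \<Omega>" for x
  proof -
    have d: "0 < ?\<delta> x" "?\<delta> x \<le> D" using infdist_frontier_pos[OF \<Omega> x] D(2)[OF x] by auto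
    have "D powr (\<gamma> + 2) * ?\<delta> x powr (-2) \<le> ?\<delta> x powr \<gamma>"
      using powr_le_powr_bounded[OF d \<gamma>] by simp
    moreover have "?\<delta> x powr (-2) = 1 / (?\<delta> x)\<^sup>2"
      using d by (simp add: powr_minus_divide)
    ultimately have 1: "1 / (?\<delta> x)\<^sup>2 \<le> ?\<delta> x powr \<gamma> / D powr (\<gamma> + 2)"
      using D(1) by (simp add: pos_le_divide_eq mult.commute)
    have "f x \<le> C * (?t / \<psi> ?t) * \<psi> (f x)" using C(2)[OF f(2), of x ?t] f(3)[of x] t by simp
    from mult_mono[OF this 1] show ?thesis
      using C(1) t permissible_nonneg[OF \<psi> f(2)[of x]] by (simp add: mult_ac)
  qed
  have int: "integrable lborel (\<lambda>x. f x / (?\<delta> x)\<^sup>2)"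
  proof (rule integrableI_nonneg)
    have "(\<integral>\<^sup>+x. ennreal (f x / (?\<delta> x)\<^sup>2) \<partial>lborel)
        \<le> (\<integral>\<^sup>+x. ennreal ?c * (ennreal (\<psi> (f x)) * ennreal (?\<delta> x powr \<gamma>) * indicator \<Omega> x) \<partial>lborel)"
    proof (intro nn_integral_mono)
      fix x :: 'a
      show "ennreal (f x / (?\<delta> x)\<^sup>2) \<le> ennreal ?c * (ennreal (\<psi> (f x)) * ennreal (?\<delta> x powr \<gamma>) * indicator \<Omega> x)"
      proof (cases "x \<in> \<Omega>")
        case True
        have "ennreal (f x / (?\<delta> x)\<^sup>2) \<le> ennreal (?c * (\<psi> (f x) * ?\<delta> x powr \<gamma>))"
          by (rule ennreal_leI[OF ptw[OF True]])
        also have "\<dots> = ennreal ?c * (ennreal (\<psi> (f x)) * ennreal (?\<delta> x powr \<gamma>))"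
          using c permissible_nonneg[OF \<psi> f(2)[of x]] by (simp only: ennreal_mult mult_nonneg_nonneg powr_ge_zero)
        finally show ?thesis using True by simp
      qed (simp add: f)
    qed
    also have "\<dots> = ennreal ?c * (\<integral>\<^sup>+x\<in>\<Omega>. ennreal (\<psi> (f x)) * ennreal (?\<delta> x powr \<gamma>) \<partial>lborel)"
      by (rule nn_integral_cmult) measurable
    also have "\<dots> < \<infinity>" using fin by (simp add: ennreal_mult_less_top)
    finally show "(\<integral>\<^sup>+x. ennreal (f x / (?\<delta> x)\<^sup>2) \<partial>lborel) < \<infinity>" .
    show "(\<lambda>x. f x / (?\<delta> x)\<^sup>2) \<in> borel_measurable lborel" by measurable
    show "AE x in lborel. 0 \<le> f x / (?\<delta> x)\<^sup>2" using f(2) by (intro AE_I2) simp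
  qed
  show ?thesis
    by (rule AE_zero_of_weighted_integrable[OF \<Omega> f(1) _ _ _ \<sigma> _ int]) (fact f(2-4) mean)+
qed

text \<open>Apply the estimate for \<open>\<psi> \<circ> u\<close> on the ball of half the boundary
  distance at \<open>x\<close>. Weight times volume there is at least a multiple of the distance to
  the power \<gamma> plus the dimension, and this stays away from 0 as the exponent is at most 0. So
  \<open>\<psi> (u x)\<close> is bounded uniformly in \<open>x\<close>.\<close>

lemma bounded_of_permissible_integral:
  fixes u :: "'a \<Rightarrow> real"
  assumes \<gamma>: "\<gamma> \<le> - real DIM('a)"
    and u: "u \<in> borel_measurable borel" "\<And>x. 0 \<le> u x"
    and bdd: "\<And>K. compact K \<Longrightarrow> K \<subseteq> \<Omega> \<Longrightarrow> \<exists>M. \<forall>x\<in>K. u x \<le> M"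
    and mean: "\<And>x r. 0 < r \<Longrightarrow> cball x r \<subseteq> \<Omega> \<Longrightarrow>
      ennreal (measure lborel (cball x r) * u x) \<le> (\<integral>\<^sup>+y\<in>cball x r. ennreal (u y) \<partial>lborel)"
    and fin: "(\<integral>\<^sup>+x\<in>\<Omega>. ennreal (\<psi> (u x)) * ennreal (infdist x (frontier \<Omega>) powr \<gamma>) \<partial>lborel) < \<infinity>"
  obtains T where "\<And>x. x \<in> \<Omega> \<Longrightarrow> u x \<le> T"
proof -
  let ?\<delta> = "\<lambda>x. infdist x (frontier \<Omega>)"
  let ?n = "real DIM('a)"
  obtain i where i: "(\<integral>\<^sup>+x\<in>\<Omega>. ennreal (\<psi> (u x)) * ennreal (?\<delta> x powr \<gamma>) \<partial>lborel) = ennreal i" "0 \<le> i"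
    using fin by (cases "\<integral>\<^sup>+x\<in>\<Omega>. ennreal (\<psi> (u x)) * ennreal (?\<delta> x powr \<gamma>) \<partial>lborel") auto
  obtain D where D: "0 < D" "\<And>x. x \<in> \<Omega> \<Longrightarrow> ?\<delta> x \<le> D" using infdist_frontier_bounded[OF \<Omega>(2)] by blast
  obtain A where A: "0 < A" and
    est: "\<And>(u :: 'a \<Rightarrow> real) x R M. \<lbrakk>0 < R; u \<in> borel_measurable borel; \<And>y. 0 \<le> u y;
      \<And>y. y \<in> cball x R \<Longrightarrow> u y \<le> M;
      \<And>y r. 0 < r \<Longrightarrow> cball y r \<subseteq> cball x R \<Longrightarrow>
        ennreal (measure lborel (cball y r) * u y) \<le> (\<integral>\<^sup>+z\<in>cball y r. ennreal (u z) \<partial>lborel)\<rbrakk> \<Longrightarrow>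
      ennreal (measure lborel (cball x R) * \<psi> (u x)) \<le> ennreal A * (\<integral>\<^sup>+z\<in>cball x R. ennreal (\<psi> (u z)) \<partial>lborel)"
    using permissible_submean_estimate[OF \<psi>] by blast
  \<comment> \<open>The factor \<open>(3/2) powr \<gamma>\<close> comes from the distance growing at
    most to 3/2 of its value on the half ball, the next two from the volume of that ball, and the
    last is the least value of the remaining power.\<close>
  define c where "c = (3/2) powr \<gamma> * unit_ball_vol ?n * (1/2) powr ?n * D powr (\<gamma> + ?n)"
  have c: "0 < c" using D(1) by (simp add: c_def)
  have est': "\<psi> (u x) \<le> A * i / c" if x: "x \<in> \<Omega>" for x
  proof -
    let ?R = "?\<delta> x / 2"
    let ?w = "(3/2 * ?\<delta> x) powr \<gamma>"
    let ?D = "\<integral>\<^sup>+z\<in>cball x ?R. ennreal (\<psi> (u z)) \<partial>lborel"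
    have d: "0 < ?\<delta> x" "?\<delta> x \<le> D" using infdist_frontier_pos[OF \<Omega> x] D(2)[OF x] by auto
    have sub: "cball x ?R \<subseteq> \<Omega>" using d x by (intro cball_subset_of_infdist_frontier \<Omega>) auto
    obtain M where M: "\<And>y. y \<in> cball x ?R \<Longrightarrow> u y \<le> M" using bdd[OF compact_cball sub] by blast
    have le: "ennreal (measure lborel (cball x ?R) * \<psi> (u x)) \<le> ennreal A * ?D"
      using d mean sub by (intro est[OF _ u M]) auto
    have "ennreal ?w * ?D = (\<integral>\<^sup>+z. ennreal ?w * (ennreal (\<psi> (u z)) * indicator (cball x ?R) z) \<partial>lborel)"
      using permissible_measurable[OF \<psi> u] 
      by (intro nn_integral_cmult[symmetric]) (auto intro!: borel_measurable_times_ennreal borel_measurable_indicator)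
    also have "\<dots> \<le> ennreal i" unfolding i(1)[symmetric]
    proof (intro nn_integral_mono)
      fix z
      show "ennreal ?w * (ennreal (\<psi> (u z)) * indicator (cball x ?R) z)
          \<le> ennreal (\<psi> (u z)) * ennreal (?\<delta> z powr \<gamma>) * indicator \<Omega> z"
      proof (cases "z \<in> cball x ?R")
        case True
        then have z: "z \<in> \<Omega>" using sub by auto
        have "?\<delta> z \<le> 3/2 * ?\<delta> x" using infdist_triangle[of z "frontier \<Omega>" x] True by (simp add: dist_commute)
        then have "?w \<le> ?\<delta> z powr \<gamma>" using infdist_frontier_pos[OF \<Omega> z] \<gamma> by (intro powr_mono2') auto
        then have "ennreal (\<psi> (u z)) * ennreal ?w \<le> ennreal (\<psi> (u z)) * ennreal (?\<delta> z powr \<gamma>)"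
          by (intro mult_left_mono ennreal_leI) auto
        then show ?thesis using True z by (simp add: mult.commute)
      qed simp
    qed
    finally have wD: "ennreal ?w * ?D \<le> ennreal i" .
    have c_le: "c \<le> ?w * measure lborel (cball x ?R)"
    proof -
      have "D powr (\<gamma> + ?n) * ?\<delta> x powr (- ?n) \<le> ?\<delta> x powr \<gamma>" using powr_le_powr_bounded[OF d \<gamma>] by simp
      then have "D powr (\<gamma> + ?n) \<le> ?\<delta> x powr \<gamma> * ?\<delta> x powr ?n"
        using d by (simp add: powr_minus divide_simps flip: powr_realpow)
      then have "(3/2) powr \<gamma> * unit_ball_vol ?n * (1/2) powr ?n * D powr (\<gamma> + ?n)
        \<le> (3/2) powr \<gamma> * unit_ball_vol ?n * (1/2) powr ?n * (?\<delta> x powr \<gamma> * ?\<delta> x powr ?n)"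
        by (intro mult_left_mono) auto
      also have "\<dots> = ?w * (unit_ball_vol ?n * (1/2 * ?\<delta> x) powr ?n)" using d by (simp only: powr_mult mult_ac)
      also have "\<dots> = ?w * measure lborel (cball x ?R)" using d by (simp add: content_cball powr_realpow)
      finally show ?thesis by (simp add: c_def)
    qed
    have p: "0 \<le> \<psi> (u x)" by (rule permissible_nonneg[OF \<psi> u(2)])
    have "ennreal (c * \<psi> (u x)) \<le> ennreal (?w * (measure lborel (cball x ?R) * \<psi> (u x)))"
      using mult_right_mono[OF c_le p] by (intro ennreal_leI) (simp add: mult.assoc)
    also have "\<dots> = ennreal ?w * ennreal (measure lborel (cball x ?R) * \<psi> (u x))" by (simp add: ennreal_mult')
    also have "\<dots> \<le> ennreal ?w * (ennreal A * ?D)" using le by (intro mult_left_mono) auto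
    also have "\<dots> = ennreal A * (ennreal ?w * ?D)" by (simp only: mult_ac)
    also have "\<dots> \<le> ennreal A * ennreal i" using wD by (intro mult_left_mono) auto
    also have "\<dots> = ennreal (A * i)" using A i(2) by (simp add: ennreal_mult)
    finally have "c * \<psi> (u x) \<le> A * i" using A i(2) by simp
    then show ?thesis using c by (simp add: pos_le_divide_eq mult.commute)
  qed
  obtain T where T: "0 \<le> T" "\<psi> T = A * i / c" using permissible_surj[OF \<psi>, of "A * i / c"] A i(2) c by auto
  show thesis
  proof (rule that)
    fix x assume "x \<in> \<Omega>"
    then show "u x \<le> T" using est'[of x] T permissible_le_iff[OF \<psi> u(2) T(1), of x] by simp
  qed
qed

section \<open>Superharmonic functions with finite weighted integral\<close>

context
  fixes v :: "'a \<Rightarrow> ereal"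
  assumes \<gamma>: "\<gamma> \<le> - real DIM('a)" and dim: "2 \<le> DIM('a)"
    and v: "superharmonic_on \<Omega> v"
    and fin: "(\<integral>\<^sup>+x\<in>\<Omega>. extend_infinity \<psi> \<bar>v x\<bar> * ennreal (infdist x (frontier \<Omega>) powr \<gamma>) \<partial>lebesgue) < \<infinity>"
begin

text \<open>Monotonicity of \<psi> transfers finiteness to real minorants of
  \<open>\<bar>v\<bar>\<close>; it serves for the negative part and for
  \<open>min 1 v\<close>.\<close>

lemma finite_integral_minorant:
  assumes "\<And>x. 0 \<le> f x" "\<And>x. x \<in> \<Omega> \<Longrightarrow> ereal (f x) \<le> \<bar>v x\<bar>"
  shows "(\<integral>\<^sup>+x\<in>\<Omega>. ennreal (\<psi> (f x)) * ennreal (infdist x (frontier \<Omega>) powr \<gamma>) \<partial>lborel) < \<infinity>"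
proof -
  have "(\<integral>\<^sup>+x\<in>\<Omega>. ennreal (\<psi> (f x)) * ennreal (infdist x (frontier \<Omega>) powr \<gamma>) \<partial>lborel)
    \<le> (\<integral>\<^sup>+x\<in>\<Omega>. extend_infinity \<psi> \<bar>v x\<bar> * ennreal (infdist x (frontier \<Omega>) powr \<gamma>) \<partial>lborel)"
  proof (intro nn_integral_mono)
    fix x
    have "ennreal (\<psi> (f x)) \<le> extend_infinity \<psi> \<bar>v x\<bar>" if "x \<in> \<Omega>"
      using assms(2)[OF that] assms(1)[of x] permissible_le_iff[OF \<psi>, of "f x" "real_of_ereal \<bar>v x\<bar>"]
      by (cases "v x") (auto simp: extend_infinity_def intro!: ennreal_leI)
    then show "ennreal (\<psi> (f x)) * ennreal (infdist x (frontier \<Omega>) powr \<gamma>) * indicator \<Omega> x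
      \<le> extend_infinity \<psi> \<bar>v x\<bar> * ennreal (infdist x (frontier \<Omega>) powr \<gamma>) * indicator \<Omega> x"
      by (auto simp: indicator_def intro: mult_right_mono)
  qed
  also have "\<dots> < \<infinity>" using fin by (simp add: nn_integral_completion)
  finally show ?thesis .
qed

text \<open>The negative part \<open>u\<close> is bounded by the uniform estimate, hence zero almost
  everywhere by the test with \<sigma> = -1. Its mean value inequality excludes exceptional
  points.\<close>

lemma superharmonic_nonneg:
  assumes x: "x \<in> \<Omega>"
  shows "0 \<le> v x"
proof -
  define u where "u = (\<lambda>x. real_of_ereal (max 0 (- (if x \<in> \<Omega> then v x else 0))))"
  have u0: "0 \<le> u x" for x by (simp add: u_def real_of_ereal_pos)
  have uout: "u x = 0" if "x \<notin> \<Omega>" for x using that by (simp add: u_def)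
  have uin: "u x = real_of_ereal (max 0 (- v x))" if "x \<in> \<Omega>" for x using that by (simp add: u_def)
  have um: "u \<in> borel_measurable borel"
    unfolding u_def using borel_measurable_lower_semicontinuous[OF \<Omega>(1) superharmonicD(1)[OF v]]
    by (intro borel_measurable_real_of_ereal borel_measurable_max borel_measurable_uminus_ereal) auto
  have mean: "ennreal (measure lborel (cball x r) * u x) \<le> (\<integral>\<^sup>+y\<in>cball x r. ennreal (u y) \<partial>lborel)"
    if "0 < r" "cball x r \<subseteq> \<Omega>" for x r
  proof -
    have "(\<integral>\<^sup>+y\<in>cball x r. ennreal (real_of_ereal (max 0 (- v y))) \<partial>lborel) = (\<integral>\<^sup>+y\<in>cball x r. ennreal (u y) \<partial>lborel)"
      using that(2) by (intro nn_integral_cong) (auto simp: indicator_def uin)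
    moreover have "x \<in> \<Omega>" using that by auto
    ultimately show ?thesis using superharmonic_neg_part_mean[OF v that] by (simp add: uin)
  qed
  have ufin: "(\<integral>\<^sup>+x\<in>\<Omega>. ennreal (\<psi> (u x)) * ennreal (infdist x (frontier \<Omega>) powr \<gamma>) \<partial>lborel) < \<infinity>"
  proof (rule finite_integral_minorant[OF u0])
    fix x assume "x \<in> \<Omega>"
    then show "ereal (u x) \<le> \<bar>v x\<bar>" using superharmonicD(2)[OF v, of x] by (cases "v x") (auto simp: uin max_def)
  qed
  obtain T where T: "\<And>x. x \<in> \<Omega> \<Longrightarrow> u x \<le> T"
  proof (rule bounded_of_permissible_integral[OF \<gamma> um u0 _ mean ufin])
    fix K assume K: "compact K" "K \<subseteq> \<Omega>"
    obtain M where M: "\<And>x. x \<in> K \<Longrightarrow> - ereal M < v x"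
      using superharmonic_bounded_below_compact[OF \<Omega>(1) v K] by blast
    have "u x \<le> max 0 M" if "x \<in> K" for x
      using M[OF that] K(2) that by (cases "v x") (auto simp: uin subset_iff max_def)
    then show "\<exists>M. \<forall>x\<in>K. u x \<le> M" by blast
  qed blast+
  have uT: "u x \<le> max 0 T" for x using T[of x] uout[of x] by (cases "x \<in> \<Omega>") auto
  have ae: "AE x in lborel. u x = 0"
  proof (rule AE_zero_of_permissible_integral[OF _ um u0 uT uout _ _ ufin, of "-1"])
    fix x r assume r: "0 < r" "cball x r \<subseteq> \<Omega>"
    have "0 \<le> (\<integral>y. indicator (cball x r) y * u y \<partial>lborel)" using u0 by (intro integral_nonneg_AE AE_I2) auto
    then show "- 1 * (\<integral>y. indicator (cball x r) y * u y \<partial>lborel) \<le> - 1 * (measure lborel (cball x r) * u x)"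
      using mean[OF r] u0[of x] by (simp add: nn_integral_cball_eq_integral[OF um u0 uT])
  qed (use \<gamma> dim in auto)
  \<comment> \<open>The integral of \<open>u\<close> over this ball is 0, and the sub-mean-value
    inequality carries this over to the centre.\<close>
  define r where "r = infdist x (frontier \<Omega>) / 2"
  have r: "0 < r" "cball x r \<subseteq> \<Omega>"
    using infdist_frontier_pos[OF \<Omega> x] x cball_subset_of_infdist_frontier[OF \<Omega>(1) x, of r] by (auto simp: r_def)
  have "(\<integral>\<^sup>+y\<in>cball x r. ennreal (u y) \<partial>lborel) = (\<integral>\<^sup>+y. 0 \<partial>(lborel :: 'a measure))"
    using ae by (intro nn_integral_cong_AE) auto
  then have "measure lborel (cball x r) * u x \<le> 0" using mean[OF r] by (simp add: ennreal_eq_0_iff)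
  moreover have "0 < measure lborel (cball x r)" using r(1) by (simp add: content_cball)
  ultimately have "u x = 0" using u0[of x] by (simp add: mult_le_0_iff)
  then show ?thesis using x superharmonicD(2)[OF v x] by (cases "v x") (auto simp: uin max_def split: if_splits)
qed

text \<open>The test with \<sigma> = 1 shows that \<open>min 1 v\<close> is zero almost everywhere.
  So the set where \<open>v > 0\<close> is null; being open by lower semicontinuity, it is
  empty.\<close>

lemma superharmonic_eq_zero:
  assumes x: "x \<in> \<Omega>"
  shows "v x = 0"
proof -
  define f where "f = (\<lambda>x. real_of_ereal (min 1 (if x \<in> \<Omega> then v x else 0)))"
  have fout: "f x = 0" if "x \<notin> \<Omega>" for x using that by (simp add: f_def)
  have fin': "f x = real_of_ereal (min 1 (v x))" if "x \<in> \<Omega>" for x using that by (simp add: f_def)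
  have f0: "0 \<le> f x" for x
    using superharmonic_nonneg[of x] fout[of x] by (cases "x \<in> \<Omega>") (auto simp: fin' real_of_ereal_pos)
  have f1: "f x \<le> 1" for x
    using superharmonic_nonneg[of x] fout[of x] by (cases "x \<in> \<Omega>"; cases "v x") (auto simp: fin' min_def one_ereal_def)
  have fm: "f \<in> borel_measurable borel"
    unfolding f_def using borel_measurable_lower_semicontinuous[OF \<Omega>(1) superharmonicD(1)[OF v]]
    by (intro borel_measurable_real_of_ereal borel_measurable_min) auto
  have "AE x in lborel. f x = 0"
  proof (rule AE_zero_of_permissible_integral[OF _ fm f0 f1 fout, of 1])
    fix x r assume r: "0 < r" "cball x r \<subseteq> \<Omega>"
    have "(\<integral>\<^sup>+y\<in>cball x r. ennreal (real_of_ereal (min 1 (v y))) \<partial>lborel) = (\<integral>\<^sup>+y\<in>cball x r. ennreal (f y) \<partial>lborel)"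
      using r(2) by (intro nn_integral_cong) (auto simp: indicator_def fin')
    moreover have "x \<in> \<Omega>" using r by auto
    ultimately have "ennreal (\<integral>y. indicator (cball x r) y * f y \<partial>lborel) \<le> ennreal (measure lborel (cball x r) * f x)"
      using superharmonic_min_one_mean[OF v superharmonic_nonneg r] by (simp add: fin' nn_integral_cball_eq_integral[OF fm f0 f1])
    then show "1 * (\<integral>y. indicator (cball x r) y * f y \<partial>lborel) \<le> 1 * (measure lborel (cball x r) * f x)"
      using f0[of x] by simp
  next
    show "(\<integral>\<^sup>+x\<in>\<Omega>. ennreal (\<psi> (f x)) * ennreal (infdist x (frontier \<Omega>) powr \<gamma>) \<partial>lborel) < \<infinity>"
    proof (rule finite_integral_minorant[OF f0])
      fix x assume "x \<in> \<Omega>"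
      then show "ereal (f x) \<le> \<bar>v x\<bar>"
        using superharmonic_nonneg[of x] by (cases "v x") (auto simp: fin' min_def one_ereal_def)
    qed
  qed (use \<gamma> dim in auto)
  moreover have "f y \<noteq> 0" if "y \<in> {y \<in> \<Omega>. 0 < v y}" for y
    using that by (cases "v y") (auto simp: fin' min_def one_ereal_def)
  ultimately have ae: "AE y in lborel. y \<notin> {y \<in> \<Omega>. 0 < v y}" by (auto elim: eventually_mono)
  have o: "open {y \<in> \<Omega>. 0 < v y}" by (rule open_superlevel[OF \<Omega>(1) superharmonicD(1)[OF v]])
  then have "{y \<in> \<Omega>. 0 < v y} \<in> null_sets lborel" using ae by (subst AE_iff_null_sets) auto
  then have "negligible {y \<in> \<Omega>. 0 < v y}" by (simp add: negligible_iff_null_sets null_sets_completionI)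
  then have "{y \<in> \<Omega>. 0 < v y} = {}" using open_not_negligible[OF o] by blast
  then have "\<not> 0 < v x" using x by blast
  then show ?thesis using superharmonic_nonneg[OF x] by simp
qed

end

end

theorem corollary4p5:
  fixes \<Omega> :: "(real ^ 'n) set"
    and v :: "real ^ 'n \<Rightarrow> ereal"
    and \<psi> :: "real \<Rightarrow> real"
    and \<gamma> :: real
  assumes "CARD('n) \<ge> 2"
    and "open \<Omega>" and "connected \<Omega>" and "\<Omega> \<noteq> {}" and "bounded \<Omega>"
    and "superharmonic_on \<Omega> v \<or> (subharmonic_on \<Omega> v \<and> (\<forall>x\<in>\<Omega>. 0 \<le> v x))"
    and "strictly_permissible \<psi>"
    and "\<gamma> \<le> - real CARD('n)"
    and "(\<integral>\<^sup>+x\<in>\<Omega>. extend_infinity \<psi> \<bar>v x\<bar> * ennreal (infdist x (frontier \<Omega>) powr \<gamma>) \<partial>lebesgue) < \<infinity>"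
  shows "\<forall>x\<in>\<Omega>. v x = 0"
proof -
  have \<gamma>: "\<gamma> \<le> - real DIM(real ^ 'n)" and dim: "2 \<le> DIM(real ^ 'n)" using assms(1,8) by simp_all
  note zero = superharmonic_eq_zero[OF assms(2,5,7) \<gamma> dim]
  show ?thesis
    using assms(6)
  proof
    assume "superharmonic_on \<Omega> v"
    then show ?thesis using zero[of v] assms(9) by blast
  next
    assume "subharmonic_on \<Omega> v \<and> (\<forall>x\<in>\<Omega>. 0 \<le> v x)"
    then have sup: "superharmonic_on \<Omega> (\<lambda>x. - v x)" by (simp add: subharmonic_on_def)
    show ?thesis
    proof
      fix x assume x: "x \<in> \<Omega>"
      \<comment> \<open>The integrand depends only on \<open>\<bar>v x\<bar>\<close>, so the
        finiteness hypothesis holds for \<open>- v\<close> as well.\<close>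
      have "- v x = 0" by (rule zero[OF sup _ x]) (use assms(9) in simp)
      then show "v x = 0" by simp
    qed
  qed
qed

end
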